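(* Let $m$ be an odd positive integer, let $D\subset\mathbb{C}$ be open and symmetric, and let $f=\mathcal{I}(F_0+\iota F_1)\in\mathcal{SR}(\Omega_D)$ be slice regular on $\Omega_D\subset\mathbb{R}^{m+1}$. Then for every integer $k\ge1$, on $\Omega_D\setminus\mathbb{R}$, $$\Delta_{m+1}^{k+1}f=-2(m-1)(m-3)\cdots(m-2k-1)\sum_{j=1}^k a_j^{(k)}\frac{\partial}{\partial x}\left(\beta^{j-2k}\partial_\beta^jf'_s\right),$$ or equivalently $$\Delta_{m+1}^{k+1}f=-2(m-1)(m-3)\cdots(m-2k-1)\sum_{j=1}^{k+1}a_j^{(k+1)}\frac{\partial}{\partial x}\left(\beta^{j-2k-2}\partial_\beta^{j-1}F_1\right),$$ where $a_j^{(k)}:=\frac{(2k-j-1)!}{(j-1)!\,(k-j)!\,(-2)^{k-j}}$ for $1\le j\le k$. In particular, $f$ is $(\gamma_m+1)$-polyharmonic with $\gamma_m=\frac{m-1}{2}$, i.e. $\Delta_{m+1}^{\frac{m+1}{2}}f=0$.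
   Context: $\mathbb{R}_m$ is the real Clifford algebra generated by $e_1,\dots,e_m$ with $e_ie_j+e_je_i=-2\delta_{ij}$. The space $\mathbb{R}^{m+1}$ is identified with the paravectors $x=x_0+\sum_{i=1}^m x_ie_i\in\mathbb{R}_m$, and $\mathbb{R}$ with $\{x: x_1=\dots=x_m=0\}$. $\mathbb{S}=\{x\in\mathbb{R}^{m+1}:x_0=0,\ x_1^2+\dots+x_m^2=1\}$. Every $x\in\mathbb{R}^{m+1}$ is $x=\alpha+J\beta$ with $\alpha=x_0$, $\beta=\sqrt{x_1^2+\dots+x_m^2}\ge0$, $J\in\mathbb{S}$ ($J$ unique if $\beta>0$). $D\subset\mathbb{C}$ is symmetric if it is invariant under complex conjugation; $\Omega_D=\{\alpha+J\beta:\alpha+i\beta\in D,\ J\in\mathbb{S}\}$. A stem function on $D$ is $F=F_0+\iota F_1:D\to\mathbb{R}_m\otimes\mathbb{R}^2$ ($\iota^2=-1$, $\iota$ commuting with $\mathbb{R}_m$) with $F_0,F_1:D\to\mathbb{R}_m$, $F_0(\bar z)=F_0(z)$, $F_1(\bar z)=-F_1(z)$. It induces the slice function $f=\mathcal{I}(F)$, $f(\alpha+J\beta)=F_0(\alpha+i\beta)+JF_1(\alpha+i\beta)$. $f$ is slice regular ($f\in\mathcal{SR}(\Omega_D)$) if $F$ is $C^1$ and $\partial_\alpha F_0=\partial_\beta F_1$, $\partial_\beta F_0=-\partial_\alpha F_1$. For a slice function $g=\mathcal{I}(G)$ with $G=G_0+\iota G_1$ of class $C^1$, the slice derivative is $\frac{\partial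 g}{\partial x}=\mathcal{I}\big(\tfrac12(\partial_\alpha G-\iota\,\partial_\beta G)\big)$, i.e. $\frac{\partial g}{\partial x}(\alpha+J\beta)=\frac12\big[(\partial_\alpha G_0+\partial_\beta G_1)+J(\partial_\alpha G_1-\partial_\beta G_0)\big]$. The spherical derivative is $f'_s(\alpha+J\beta)=\beta^{-1}F_1(\alpha+i\beta)$ on $\Omega_D\setminus\mathbb{R}$. The functions $\beta^{j-2k}\partial_\beta^jf'_s$ and $\beta^{j-2k-2}\partial_\beta^{j-1}F_1$ depend only on $(\alpha,\beta)$ and are regarded as slice functions on $\Omega_D\setminus\mathbb{R}$ (with vanishing $\iota$-component). $\Delta_{m+1}=\sum_{i=0}^m\partial_{x_i}^2$. *)

theory Defs
  imports "HOL-Analysis.Analysis"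
begin

section \<open>The Clifford algebra\<close>

text \<open>
  The type index \<open>'n\<close> stands for \<open>{1,...,m}\<close>, so \<open>m = CARD('n)\<close>; the linear order fixes the
  basis \<open>e\<^sub>A = e\<^sub>i\<^sub>1 \<cdots> e\<^sub>i\<^sub>r\<close> (\<open>A = {i\<^sub>1 < \<dots> < i\<^sub>r}\<close>) in which elements are written.  The
  vector space structure, norm and topology are those of \<open>real ^ 'n set\<close>, but the library
  product \<open>*\<close> on that type is componentwise; the Clifford product is \<open>\<odot>\<close> below.
\<close>

type_synonym 'n clifford = "real ^ 'n set"

definition cl_basis :: "'n::{finite,linorder} set \<Rightarrow> 'n clifford" where
  "cl_basis A = axis A 1"

abbreviation cl_one :: "'n::{finite,linorder} clifford" where
  "cl_one \<equiv> cl_basis {}"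

abbreviation cl_gen :: "'n::{finite,linorder} \<Rightarrow> 'n clifford" where
  "cl_gen i \<equiv> cl_basis {i}"

text \<open>
  Sorting \<open>e\<^sub>A e\<^sub>B\<close> costs a sign for each pair \<open>(a, b)\<close> with \<open>b < a\<close>, and each common index
  contributes \<open>e\<^sub>a\<^sup>2 = - 1\<close>.
\<close>

definition cl_sign :: "'n::{finite,linorder} set \<Rightarrow> 'n set \<Rightarrow> real" where
  "cl_sign A B = (\<Prod>a\<in>A. \<Prod>b\<in>B. if b \<le> a then - 1 else 1)"

definition cl_mult ::
    "'n::{finite,linorder} clifford \<Rightarrow> 'n clifford \<Rightarrow> 'n clifford" (infixl "\<odot>" 70) where
  "u \<odot> v = (\<Sum>A\<in>UNIV. \<Sum>B\<in>UNIV.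
      (u $ A * v $ B * cl_sign A B) *\<^sub>R cl_basis ((A - B) \<union> (B - A)))"

lemma bilinear_cl_mult: "bilinear (cl_mult :: 'n::{finite,linorder} clifford \<Rightarrow> _)"
  unfolding bilinear_def cl_mult_def
  by (auto intro!: linearI simp: algebra_simps sum.distrib scaleR_sum_right)

lemma cl_basis_expansion: "(u :: 'n::{finite,linorder} clifford) = (\<Sum>A\<in>UNIV. u $ A *\<^sub>R cl_basis A)"
  by (simp add: vec_eq_iff cl_basis_def axis_def if_distrib[of "(*) _"] cong: if_cong)

lemma cl_mult_basis:
  "cl_basis A \<odot> cl_basis B = cl_sign A B *\<^sub>R cl_basis ((A - B) \<union> (B - A))"
proof -
  have "cl_basis A \<odot> cl_basis B = (\<Sum>A'\<in>UNIV. \<Sum>B'\<in>UNIV.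
      if A' = A then if B' = B then cl_sign A B *\<^sub>R cl_basis ((A - B) \<union> (B - A)) else 0 else 0)"
    unfolding cl_mult_def by (intro sum.cong refl) (auto simp: cl_basis_def axis_def)
  also have "\<dots> = (\<Sum>A'\<in>UNIV. if A' = A then
      (\<Sum>B'\<in>UNIV. if B' = B then cl_sign A B *\<^sub>R cl_basis ((A - B) \<union> (B - A)) else 0) else 0)"
    by (intro sum.cong refl) auto
  finally show ?thesis by simp
qed

lemma prod_sym_diff:
  fixes f :: "'a::finite \<Rightarrow> real"
  assumes "\<And>a. f a * f a = 1"
  shows "prod f ((A - B) \<union> (B - A)) = prod f A * prod f B"
proof -
  have A: "prod f A = prod f (A - B) * prod f (A \<inter> B)"
    by (subst prod.union_disjoint[symmetric]) (auto intro!: arg_cong[where f = "prod f"])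
  have B: "prod f B = prod f (B - A) * prod f (A \<inter> B)"
    by (subst prod.union_disjoint[symmetric]) (auto intro!: arg_cong[where f = "prod f"])
  have "prod f (A \<inter> B) * prod f (A \<inter> B) = 1"
    using assms by (simp flip: prod.distrib)
  then have "prod f A * prod f B = prod f (A - B) * prod f (B - A)"
    unfolding A B by (simp add: mult.assoc mult.left_commute)
  moreover have "prod f ((A - B) \<union> (B - A)) = prod f (A - B) * prod f (B - A)"
    by (intro prod.union_disjoint) auto
  ultimately show ?thesis by simp
qed

lemma cl_sign_sym_diff_left:
  "cl_sign ((A - B) \<union> (B - A)) C = cl_sign A C * cl_sign B C"
  unfolding cl_sign_def by (rule prod_sym_diff) (auto simp flip: prod.distrib intro!: prod.neutral)

lemma cl_sign_sym_diff_right: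
  "cl_sign C ((A - B) \<union> (B - A)) = cl_sign C A * cl_sign C B"
  unfolding cl_sign_def
  by (subst prod_sym_diff) (simp_all add: prod.distrib)

lemma cl_mult_one: "cl_one \<odot> u = u" "u \<odot> cl_one = u"
proof -
  interpret bilin: bounded_bilinear "cl_mult :: 'a clifford \<Rightarrow> _"
    using bilinear_cl_mult bilinear_conv_bounded_bilinear by blast
  have 1: "cl_one \<odot> cl_basis A = cl_basis A" "cl_basis A \<odot> cl_one = cl_basis A" for A :: "'a set"
    by (simp_all add: cl_mult_basis) (simp_all add: cl_sign_def)
  show "cl_one \<odot> u = u" "u \<odot> cl_one = u"
    by (subst (1 2) cl_basis_expansion[of u],
        simp add: bilin.sum_left bilin.sum_right bilin.scaleR_left bilin.scaleR_right 1)+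
qed

lemma cl_mult_assoc: "(u \<odot> v) \<odot> w = u \<odot> (v \<odot> w)"
proof -
  interpret bilin: bounded_bilinear "cl_mult :: 'a clifford \<Rightarrow> _"
    using bilinear_cl_mult bilinear_conv_bounded_bilinear by blast
  have 1: "(cl_basis A \<odot> cl_basis B) \<odot> cl_basis C = cl_basis A \<odot> (cl_basis B \<odot> cl_basis C)"
    for A B C :: "'a set"
  proof -
    have "((A - B \<union> (B - A)) - C) \<union> (C - (A - B \<union> (B - A)))
        = (A - (B - C \<union> (C - B))) \<union> ((B - C \<union> (C - B)) - A)"
      by blast
    then show ?thesis
      by (simp add: cl_mult_basis bilin.scaleR_left bilin.scaleR_right
          cl_sign_sym_diff_left cl_sign_sym_diff_right)
  qed
  show ?thesis
    by (subst (1 2) cl_basis_expansion[of u], subst (1 2) cl_basis_expansion[of v],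
        subst (1 2) cl_basis_expansion[of w])
      (simp add: bilin.sum_left bilin.sum_right bilin.scaleR_left bilin.scaleR_right 1)
qed

lemma cl_gen_relations:
  "cl_gen i \<odot> cl_gen j + cl_gen j \<odot> cl_gen i = (if i = j then - 2 else 0) *\<^sub>R cl_one"
  by (cases i j rule: linorder_cases)
    (auto simp: cl_mult_basis cl_sign_def insert_commute insert_Diff_if scaleR_2)

lemma cl_basis_insert:
  "(\<And>a. a \<in> A \<Longrightarrow> i < a) \<Longrightarrow> cl_basis (insert i A) = cl_gen i \<odot> cl_basis A"
proof -
  assume i: "\<And>a. a \<in> A \<Longrightarrow> i < a"
  then have "({i} - A) \<union> (A - {i}) = insert i A" by blast
  moreover have "cl_sign {i} A = 1"
    unfolding cl_sign_def using i by (auto intro!: prod.neutral simp: not_le)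
  ultimately show ?thesis by (simp add: cl_mult_basis)
qed

section \<open>Paravectors\<close>

text \<open>
  A point \<open>x\<close> of the space of dimension \<open>m + 1\<close> is the pair of \<open>x\<^sub>0\<close> and \<open>(x\<^sub>1,\<dots>,x\<^sub>m)\<close>.
\<close>

type_synonym 'n paravec = "real \<times> (real ^ 'n)"

definition para :: "'n::{finite,linorder} paravec \<Rightarrow> 'n clifford" where
  "para x = fst x *\<^sub>R cl_one + (\<Sum>i\<in>UNIV. snd x $ i *\<^sub>R cl_gen i)"

definition real_axis :: "'n::{finite,linorder} paravec set" where
  "real_axis = {x. \<forall>i. snd x $ i = 0}"

definition imag_units :: "'n::{finite,linorder} paravec set" where
  "imag_units = {x. fst x = 0 \<and> (\<Sum>i\<in>UNIV. (snd x $ i)\<^sup>2) = 1}"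

definition symmetric_set :: "complex set \<Rightarrow> bool" where
  "symmetric_set D \<longleftrightarrow> cnj ` D = D"

definition circular_set :: "complex set \<Rightarrow> 'n::{finite,linorder} paravec set" where
  "circular_set D = {(\<alpha>, 0) + \<beta> *\<^sub>R J | \<alpha> \<beta> J. Complex \<alpha> \<beta> \<in> D \<and> J \<in> imag_units}"

section \<open>Derivatives\<close>

text \<open>
  The value is unspecified where the derivative does not exist; below, derivatives are taken only
  of functions that are smooth near the point in question.
\<close>

definition dir_deriv ::
    "'a::real_normed_vector \<Rightarrow> ('a \<Rightarrow> 'b::real_normed_vector) \<Rightarrow> 'a \<Rightarrow> 'b" where
  "dir_deriv v g x = vector_derivative (\<lambda>t. g (x + t *\<^sub>R v)) (at 0)"

abbreviation d_alpha :: "(complex \<Rightarrow> 'b::real_normed_vector) \<Rightarrow> complex \<Rightarrow> 'b" where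
  "d_alpha \<equiv> dir_deriv 1"

abbreviation d_beta :: "(complex \<Rightarrow> 'b::real_normed_vector) \<Rightarrow> complex \<Rightarrow> 'b" where
  "d_beta \<equiv> dir_deriv \<i>"

definition laplacian ::
    "('a::euclidean_space \<Rightarrow> 'b::real_normed_vector) \<Rightarrow> 'a \<Rightarrow> 'b" where
  "laplacian g x = (\<Sum>b\<in>Basis. dir_deriv b (dir_deriv b g) x)"

definition C1_on ::
    "'a::real_normed_vector set \<Rightarrow> ('a \<Rightarrow> 'b::real_normed_vector) \<Rightarrow> bool" where
  "C1_on D g \<longleftrightarrow> (\<exists>g'. (\<forall>z\<in>D. (g has_derivative blinfun_apply (g' z)) (at z)) \<and> continuous_on D g')"

section \<open>Stem functions and slice functions\<close>

text \<open>
  The pair \<open>(a, b)\<close> encodes \<open>a + \<iota> b\<close> in the tensor product of the Clifford algebra with the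
  plane.
\<close>

type_synonym 'n stem = "complex \<Rightarrow> 'n clifford \<times> 'n clifford"

definition iota_mult :: "'n::{finite,linorder} clifford \<times> 'n clifford \<Rightarrow> 'n clifford \<times> 'n clifford" where
  "iota_mult p = (- snd p, fst p)"

definition stem_function :: "complex set \<Rightarrow> 'n::{finite,linorder} stem \<Rightarrow> bool" where
  "stem_function D F \<longleftrightarrow> (\<forall>z\<in>D. fst (F (cnj z)) = fst (F z) \<and> snd (F (cnj z)) = - snd (F z))"

text \<open>
  Here \<open>\<beta> = norm (snd x)\<close> and \<open>J = (0, sgn (snd x))\<close>.  On the real axis this \<open>J\<close> is \<open>0\<close> rather
  than an imaginary unit, which is immaterial because the \<open>\<iota>\<close>-component of a stem function
  vanishes there.
\<close>

definition slice_fun :: "'n::{finite,linorder} stem \<Rightarrow> 'n paravec \<Rightarrow> 'n clifford" where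
  "slice_fun F x = (let z = Complex (fst x) (norm (snd x))
     in fst (F z) + para (0, sgn (snd x)) \<odot> snd (F z))"

lemma slice_fun_eq:
  fixes F :: "'n::{finite,linorder} stem"
  assumes F: "stem_function D F" and z: "Complex \<alpha> \<beta> \<in> D" and J: "J \<in> imag_units"
  shows "slice_fun F ((\<alpha>, 0) + \<beta> *\<^sub>R J) = fst (F (Complex \<alpha> \<beta>)) + para J \<odot> snd (F (Complex \<alpha> \<beta>))"
proof -
  interpret bilin: bounded_bilinear "cl_mult :: 'n clifford \<Rightarrow> _"
    using bilinear_cl_mult bilinear_conv_bounded_bilinear by blast
  obtain v where v: "J = (0, v)" "norm v = 1"
    using J by (cases J) (auto simp: imag_units_def norm_vec_def L2_set_def)
  have parity: "fst (F (Complex \<alpha> (- \<beta>))) = fst (F (Complex \<alpha> \<beta>))"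
    "snd (F (Complex \<alpha> (- \<beta>))) = - snd (F (Complex \<alpha> \<beta>))"
    using F z by (auto simp: stem_function_def complex_cnj dest!: bspec[of _ _ "Complex \<alpha> \<beta>"])
  have neg: "para (0, - v) = - para (0, v)"
    by (simp add: para_def sum_negf)
  have sgnv: "sgn v = v"
    using v by (simp add: sgn_div_norm)
  consider "\<beta> > 0" | "\<beta> = 0" | "\<beta> < 0" by linarith
  then show ?thesis
  proof cases
    case 1
    then show ?thesis using v sgnv by (simp add: slice_fun_def Let_def sgn_scaleR)
  next
    case 2
    then have "snd (F (Complex \<alpha> 0)) = 0" using parity by (simp add: eq_neg_iff_add_eq_0 flip: scaleR_2)
    then show ?thesis using v 2 by (simp add: slice_fun_def Let_def bilin.zero_right)
  next
    case 3
    then show ?thesis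
      using v sgnv parity neg by (simp add: slice_fun_def Let_def sgn_scaleR bilin.minus_left bilin.minus_right)
  qed
qed

definition slice_regular ::
    "complex set \<Rightarrow> 'n::{finite,linorder} stem \<Rightarrow> ('n paravec \<Rightarrow> 'n clifford) \<Rightarrow> bool" where
  "slice_regular D F f \<longleftrightarrow>
     stem_function D F \<and> (\<forall>x\<in>circular_set D. f x = slice_fun F x) \<and> C1_on D F \<and>
     (\<forall>z\<in>D. d_alpha (\<lambda>w. fst (F w)) z = d_beta (\<lambda>w. snd (F w)) z \<and>
            d_beta (\<lambda>w. fst (F w)) z = - d_alpha (\<lambda>w. snd (F w)) z)"

text \<open>
  The slice derivative of the slice function induced by the stem function \<open>G\<close>.
\<close>

definition slice_deriv :: "'n::{finite,linorder} stem \<Rightarrow> 'n paravec \<Rightarrow> 'n clifford" where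
  "slice_deriv G = slice_fun (\<lambda>z. (1 / 2) *\<^sub>R (d_alpha G z - iota_mult (d_beta G z)))"

text \<open>
  The spherical derivative depends only on \<open>(\<alpha>, \<beta>)\<close> and is given as a function of
  \<open>\<alpha> + i \<beta>\<close> off the real line.
\<close>

definition spherical_deriv :: "'n::{finite,linorder} stem \<Rightarrow> complex \<Rightarrow> 'n clifford" where
  "spherical_deriv F z = inverse (Im z) *\<^sub>R snd (F z)"

text \<open>
  A function of \<open>(\<alpha>, \<beta>)\<close> regarded as a stem function with vanishing \<open>\<iota>\<close>-component.
\<close>

definition stem_of :: "(complex \<Rightarrow> 'n::{finite,linorder} clifford) \<Rightarrow> 'n stem" where
  "stem_of g z = (g z, 0)"

definition acoeff :: "nat \<Rightarrow> nat \<Rightarrow> real" where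
  "acoeff k j = fact (2 * k - j - 1) / (fact (j - 1) * fact (k - j) * (- 2) ^ (k - j))"

end

theory Submission
  imports Defs "HOL-Complex_Analysis.Complex_Analysis"
begin

text \<open>
  Componentwise, the stem function of \<open>f\<close> is a holomorphic function \<open>h\<close> with
  \<open>h (cnj z) = cnj (h z)\<close>.  Put \<open>T = \<beta>\<^sup>-\<^sup>1 \<partial>\<^sub>\<beta>\<close> and \<open>\<phi>\<^sub>k = T\<^sup>k f'\<^sub>s\<close>;
  the \<open>a\<^sub>j\<^sup>(\<^sup>k\<^sup>)\<close> are the coefficients of \<open>T\<^sup>k\<close>.  Since \<open>\<beta> f'\<^sub>s\<close> is harmonic,
  induction gives \<open>\<partial>\<^sub>\<alpha>\<^sup>2 \<phi>\<^sub>k + \<beta>\<^sup>2 \<phi>\<^sub>k\<^sub>+\<^sub>2 + (2 k + 3) \<phi>\<^sub>k\<^sub>+\<^sub>1 = 0\<close>, so the Laplacian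
  sends \<open>f\<close> to \<open>- 2 (m - 1)\<close> times the slice derivative of \<open>\<phi>\<^sub>0\<close> and the slice derivative
  of \<open>\<phi>\<^sub>k\<close> to \<open>m - 2 k - 3\<close> times that of \<open>\<phi>\<^sub>k\<^sub>+\<^sub>1\<close>.

  Polyharmonicity on the real axis needs no limit argument: along \<open>\<beta>\<close>, near a real point,
  each \<open>\<phi>\<^sub>k\<close> is a power series in \<open>\<beta>\<^sup>2\<close>, and this suffices for the same computation with
  partial derivatives to be valid there.
\<close>

section \<open>Directional derivatives\<close>

text \<open>Unlike a value of \<open>dir_deriv\<close>, this relation asserts existence, so
  derivatives can be compared by uniqueness. It looks along one line only, which is all that the
  argument at real points supplies.\<close>

definition has_dir_deriv ::
    "('a::real_normed_vector \<Rightarrow> 'b::real_normed_vector) \<Rightarrow> 'b \<Rightarrow> 'a \<Rightarrow> 'a \<Rightarrow> bool" where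
  "has_dir_deriv g g' v x \<longleftrightarrow> ((\<lambda>t. g (x + t *\<^sub>R v)) has_vector_derivative g') (at 0)"

lemma dir_deriv_eq: "has_dir_deriv g g' v x \<Longrightarrow> dir_deriv v g x = g'"
  unfolding has_dir_deriv_def dir_deriv_def by (rule vector_derivative_at)

lemma has_dir_deriv_unique: "has_dir_deriv g a v x \<Longrightarrow> has_dir_deriv g b v x \<Longrightarrow> a = b"
  using dir_deriv_eq by metis

lemma has_derivative_imp_has_dir_deriv:
  assumes "(g has_derivative g') (at x)"
  shows "has_dir_deriv g (g' v) v x"
proof -
  have "((\<lambda>t. x + t *\<^sub>R v) has_vector_derivative v) (at 0)"
    by (auto intro!: derivative_eq_intros)
  then have "((g \<circ> (\<lambda>t. x + t *\<^sub>R v)) has_vector_derivative g' v) (at 0)"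
    using assms vector_derivative_diff_chain_within[of "\<lambda>t. x + t *\<^sub>R v" v 0 UNIV g g']
    by (auto intro: has_derivative_at_withinI)
  then show ?thesis by (simp add: has_dir_deriv_def o_def)
qed

lemma has_dir_deriv_cong:
  assumes "has_dir_deriv g g' v x" and "open S" "x \<in> S" and "\<And>y. y \<in> S \<Longrightarrow> g y = k y"
  shows "has_dir_deriv k g' v x"
proof -
  have "open ((\<lambda>t. x + t *\<^sub>R v) -` S)"
    by (intro open_vimage continuous_intros \<open>open S\<close>)
  then show ?thesis
    using assms unfolding has_dir_deriv_def
    by (auto intro: has_vector_derivative_transform_within_open)
qed

text \<open>Existence is not at issue: both functions have the same candidate derivatives, so even
  an unspecified value is the same.\<close>

lemma dir_deriv_cong:
  assumes "open S" "x \<in> S" and "\<And>y. y \<in> S \<Longrightarrow> g y = k y"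
  shows "dir_deriv v g x = dir_deriv v k x"
proof -
  have "has_dir_deriv g l v x \<longleftrightarrow> has_dir_deriv k l v x" for l
    using has_dir_deriv_cong[of g l v x S k] has_dir_deriv_cong[of k l v x S g] assms by auto
  then show ?thesis
    unfolding dir_deriv_def has_dir_deriv_def vector_derivative_def by simp
qed

lemma has_dir_deriv_const: "has_dir_deriv (\<lambda>x. c) 0 v x"
  unfolding has_dir_deriv_def by simp

lemma has_dir_deriv_add:
  "has_dir_deriv g g' v x \<Longrightarrow> has_dir_deriv k k' v x \<Longrightarrow> has_dir_deriv (\<lambda>x. g x + k x) (g' + k') v x"
  unfolding has_dir_deriv_def by (rule has_vector_derivative_add)

lemma has_dir_deriv_sum:
  "(\<And>i. i \<in> I \<Longrightarrow> has_dir_deriv (g i) (g' i) v x) \<Longrightarrow>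
    has_dir_deriv (\<lambda>x. \<Sum>i\<in>I. g i x) (\<Sum>i\<in>I. g' i) v x"
  unfolding has_dir_deriv_def by (rule has_vector_derivative_sum)

lemma has_dir_deriv_linear:
  "bounded_linear L \<Longrightarrow> has_dir_deriv g g' v x \<Longrightarrow> has_dir_deriv (\<lambda>x. L (g x)) (L g') v x"
  unfolding has_dir_deriv_def by (rule bounded_linear.has_vector_derivative)

lemmas has_dir_deriv_scaleR_const = has_dir_deriv_linear[OF bounded_linear_scaleR_right]

lemma has_dir_deriv_bilinear:
  assumes "bounded_bilinear p" and "has_dir_deriv c c' v x" and "has_dir_deriv g g' v x"
  shows "has_dir_deriv (\<lambda>x. p (c x) (g x)) (p (c x) g' + p c' (g x)) v x"
  using bounded_bilinear.has_vector_derivative[OF assms(1), of _ c' 0 UNIV] assms(2,3)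
  unfolding has_dir_deriv_def by fastforce

lemmas has_dir_deriv_scaleR = has_dir_deriv_bilinear[OF bounded_bilinear_scaleR]

text \<open>This carries results on scalar components over to Clifford-valued functions.\<close>

lemma has_dir_deriv_vec:
  fixes g :: "'a::finite \<Rightarrow> 'b::real_normed_vector \<Rightarrow> real"
  assumes "\<And>i. has_dir_deriv (g i) (g' i) v x"
  shows "has_dir_deriv (\<lambda>x. \<chi> i. g i x) (\<chi> i. g' i) v x"
proof -
  have eq: "(\<chi> i. u i) = (\<Sum>i\<in>UNIV. u i *\<^sub>R axis i 1)" for u :: "'a \<Rightarrow> real"
    by (simp add: vec_eq_iff axis_def if_distrib[of "(*) _"] cong: if_cong)
  have "has_dir_deriv (\<lambda>x. \<Sum>i\<in>UNIV. g i x *\<^sub>R axis i 1) (\<Sum>i\<in>UNIV. g' i *\<^sub>R (axis i 1 :: real ^ 'a)) v x"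
    by (intro has_dir_deriv_sum has_dir_deriv_linear[OF bounded_linear_scaleR_left] assms)
  then show ?thesis by (simp add: eq)
qed

lemma has_dir_deriv_Im_powi:
  assumes "Im z \<noteq> 0"
  shows "has_dir_deriv (\<lambda>z. Im z powi n) (of_int n * Im z powi (n - 1)) \<i> z"
    and "has_dir_deriv (\<lambda>z. Im z powi n) 0 1 z"
proof -
  have "((\<lambda>t. (Im z + t) powi n) has_real_derivative of_int n * Im z powi (n - 1)) (at 0)"
    using assms by (auto intro!: derivative_eq_intros)
  then show "has_dir_deriv (\<lambda>z. Im z powi n) (of_int n * Im z powi (n - 1)) \<i> z"
    by (simp add: has_dir_deriv_def has_real_derivative_iff_has_vector_derivative)
  show "has_dir_deriv (\<lambda>z. Im z powi n) 0 1 z"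
    by (simp add: has_dir_deriv_def)
qed

lemma open_Im_nonzero: "open {z. Im z \<noteq> 0}"
  by (intro open_Collect_neq continuous_intros)

section \<open>The coefficients\<close>

text \<open>With j = n + 1 and k = n + p + 1 the truncated subtractions in \<open>acoeff\<close>
  disappear.\<close>

lemma acoeff_shift: "acoeff (n + p + 1) (n + 1) = fact (n + 2 * p) / (fact n * fact p * (- 2) ^ p)"
  by (simp add: acoeff_def algebra_simps)

lemma fact_add_2: "(fact (n + 2) :: real) = (real n + 2) * (real n + 1) * fact n"
  by (simp add: numeral_2_eq_2 algebra_simps)

lemma sum_head: "(\<Sum>j=1..Suc n. g j) = g 1 + (\<Sum>j=1..n. g (Suc j))"
  for g :: "nat \<Rightarrow> 'a::comm_monoid_add"
  by (induction n) (simp_all add: add.assoc)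

lemma acoeff_diag: "k \<ge> 1 \<Longrightarrow> acoeff k k = 1"
proof -
  assume "k \<ge> 1"
  then have "2 * k - k - 1 = k - 1" by simp
  then show ?thesis by (simp add: acoeff_def)
qed

lemma acoeff_first:
  assumes "k \<ge> 1" shows "acoeff (Suc k) 1 = (1 - 2 * real k) * acoeff k 1"
proof -
  obtain p where k: "k = p + 1" using assms by (metis add.commute le_Suc_ex)
  have 1: "acoeff (Suc k) 1 = fact (2 * p + 2) / (fact (p + 1) * (- 2) ^ (p + 1))"
    using acoeff_shift[of 0 "p + 1"] by (simp add: k)
  have 2: "acoeff k 1 = fact (2 * p) / (fact p * (- 2) ^ p)"
    using acoeff_shift[of 0 p] by (simp add: k)
  have r: "real k = real p + 1" "(fact (p + 1) :: real) = (real p + 1) * fact p"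
    by (simp_all add: k)
  show ?thesis
    unfolding 1 2 r fact_add_2 power_add
    by (simp add: divide_simps del: fact_Suc) (simp add: algebra_simps)
qed

text \<open>This is the Leibniz rule for \<beta>^(-1) d/d\<beta> on the terms \<beta>^(j - 2k)
  d^j/d\<beta>^j: differentiating the power gives the first summand, raising the order of the
  derivative gives the second. \<open>acoeff_first\<close> is the boundary case without a second
  summand.\<close>

lemma acoeff_rec:
  assumes "1 \<le> j" "j < k"
  shows "acoeff (Suc k) (Suc j) = (real j + 1 - 2 * real k) * acoeff k (Suc j) + acoeff k j"
proof -
  obtain n where j: "j = n + 1" using assms(1) by (metis add.commute le_Suc_ex)
  obtain p where k: "k = n + p + 2"
    using assms(2) unfolding j by (metis add.assoc add.commute add_2_eq_Suc' less_iff_Suc_add add_Suc_right Suc_eq_plus1)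
  have 1: "acoeff (Suc k) (Suc j) = fact (n + 2 * p + 3) / (fact (n + 1) * fact (p + 1) * (- 2) ^ (p + 1))"
    using acoeff_shift[of "n + 1" "p + 1"] by (simp add: j k eval_nat_numeral)
  have 2: "acoeff k (Suc j) = fact (n + 2 * p + 1) / (fact (n + 1) * fact p * (- 2) ^ p)"
    using acoeff_shift[of "n + 1" p] by (simp add: j k eval_nat_numeral)
  have 3: "acoeff k j = fact (n + 2 * p + 2) / (fact n * fact (p + 1) * (- 2) ^ (p + 1))"
    using acoeff_shift[of n "p + 1"] by (simp add: j k eval_nat_numeral)
  have N: "n + 2 * p + 3 = (n + 2 * p + 1) + 2" "n + 2 * p + 2 = Suc (n + 2 * p + 1)"
    by simp_all
  \<comment> \<open>\<open>R\<close> is a common factor of the three coefficients. After removing it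
    and (a + 2b + 2) / (-2), the claim is a + 2b + 3 = 2 (b + 1) + (a + 1).\<close>
  define a b Q R where "a = real n" and "b = real p" and "Q = (fact (n + 2 * p + 1) :: real)"
    and "R = Q / ((a + 1) * fact n * ((b + 1) * fact p) * (- 2) ^ p)"
  have [simp]: "a + 1 \<noteq> 0" "b + 1 \<noteq> 0" by (simp_all add: a_def b_def)
  have "(fact (n + 2 * p + 3) :: real) = (a + 2 * b + 3) * (a + 2 * b + 2) * Q"
    using fact_add_2[of "n + 2 * p + 1"] unfolding N(1) by (simp add: a_def b_def Q_def add_ac)
  moreover have "(fact (n + 2 * p + 2) :: real) = (a + 2 * b + 2) * Q"
    unfolding N(2) fact_Suc Q_def by (simp add: a_def b_def add_ac)
  moreover have "(fact (n + 1) :: real) = (a + 1) * fact n" "(fact (p + 1) :: real) = (b + 1) * fact p"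
    by (simp_all add: a_def b_def add_ac)
  ultimately have "acoeff (Suc k) (Suc j) = (a + 2 * b + 3) * (a + 2 * b + 2) * R / (- 2)"
    "acoeff k (Suc j) = (b + 1) * R" "acoeff k j = (a + 1) * (a + 2 * b + 2) * R / (- 2)"
    unfolding 1 2 3 R_def power_add Q_def[symmetric] by (simp_all, simp_all add: add_ac)
  moreover have "real j = a + 1" "real k = a + b + 2" by (simp_all add: j k a_def b_def)
  ultimately show ?thesis by (simp add: field_simps)
qed

section \<open>Iterating the operator \<open>\<beta>\<^sup>-\<^sup>1 \<partial>\<^sub>\<beta>\<close>\<close>

text \<open>
  If \<open>u j\<close> is the \<open>j\<close>-th \<open>\<beta>\<close>-derivative of a function \<open>u 0\<close>, this is
  \<open>(\<beta>\<^sup>-\<^sup>1 \<partial>\<^sub>\<beta>)\<^sup>k (u 0)\<close>.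
\<close>

definition weighted_sum :: "nat \<Rightarrow> (nat \<Rightarrow> complex \<Rightarrow> 'b::real_normed_vector) \<Rightarrow> complex \<Rightarrow> 'b" where
  "weighted_sum k u z = (\<Sum>j=1..k. (acoeff k j * Im z powi (int j - 2 * int k)) *\<^sub>R u j z)"

lemma weighted_sum_alpha:
  assumes "Im z \<noteq> 0" and "\<And>j. has_dir_deriv (u j) (u' j z) 1 z"
  shows "has_dir_deriv (weighted_sum k u) (weighted_sum k u' z) 1 z"
proof -
  have "has_dir_deriv (\<lambda>z. \<Sum>j=1..k. acoeff k j *\<^sub>R (Im z powi (int j - 2 * int k) *\<^sub>R u j z))
     (\<Sum>j=1..k. acoeff k j *\<^sub>R (Im z powi (int j - 2 * int k) *\<^sub>R u' j z + 0 *\<^sub>R u j z)) 1 z"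
    by (intro has_dir_deriv_sum has_dir_deriv_scaleR_const has_dir_deriv_scaleR
        has_dir_deriv_Im_powi assms)
  then show ?thesis by (simp add: weighted_sum_def[abs_def])
qed

text \<open>Apply the Leibniz rule to each summand and collect the coefficient of each
  \<open>u j\<close>. The hypothesis on \<open>u\<close> starts at j = 1, which admits the shifted
  family \<open>deriv_Im h (j - 1)\<close>.\<close>

lemma weighted_sum_beta:
  assumes "k \<ge> 1" and z: "Im z \<noteq> 0" and u: "\<And>j. j \<ge> 1 \<Longrightarrow> has_dir_deriv (u j) (u (Suc j) z) \<i> z"
  shows "has_dir_deriv (weighted_sum k u) (Im z *\<^sub>R weighted_sum (Suc k) u z) \<i> z"
proof -
  define b where "b = Im z"
  \<comment> \<open>\<open>w j\<close> is \<open>Im z\<close> times the weight of \<open>u j\<close>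
    in the sum for \<open>Suc k\<close>; the factor \<open>Im z\<close> is pulled out at the
    end.\<close>
  define w where "w j = b powi (int j - 2 * int k - 1)" for j
  have w: "w (Suc j) = b powi (int j - 2 * int k)" for j by (simp add: w_def)
  obtain n where k: "k = Suc n" using \<open>k \<ge> 1\<close> by (metis Suc_le_D One_nat_def)
  have "has_dir_deriv (\<lambda>z. \<Sum>j=1..k. acoeff k j *\<^sub>R (Im z powi (int j - 2 * int k) *\<^sub>R u j z))
     (\<Sum>j=1..k. acoeff k j *\<^sub>R (Im z powi (int j - 2 * int k) *\<^sub>R u (Suc j) z
        + (of_int (int j - 2 * int k) * Im z powi (int j - 2 * int k - 1)) *\<^sub>R u j z)) \<i> z"
    using z by (intro has_dir_deriv_sum has_dir_deriv_scaleR_const has_dir_deriv_scaleR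
        has_dir_deriv_Im_powi u) auto
  also have "(\<Sum>j=1..k. acoeff k j *\<^sub>R (Im z powi (int j - 2 * int k) *\<^sub>R u (Suc j) z
        + (of_int (int j - 2 * int k) * Im z powi (int j - 2 * int k - 1)) *\<^sub>R u j z))
      = (\<Sum>j=1..k. (acoeff k j * w (Suc j)) *\<^sub>R u (Suc j) z)
        + (\<Sum>j=1..k. ((real j - 2 * real k) * acoeff k j * w j) *\<^sub>R u j z)"
    by (simp add: w sum.distrib scaleR_add_right flip: b_def) (simp add: w_def mult_ac)
  also have "(\<Sum>j=1..k. (acoeff k j * w (Suc j)) *\<^sub>R u (Suc j) z)
      = (\<Sum>j=1..n. (acoeff k j * w (Suc j)) *\<^sub>R u (Suc j) z) + w (Suc k) *\<^sub>R u (Suc k) z"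
    using acoeff_diag[OF \<open>k \<ge> 1\<close>] by (simp add: k)
  also have "(\<Sum>j=1..k. ((real j - 2 * real k) * acoeff k j * w j) *\<^sub>R u j z)
      = ((1 - 2 * real k) * acoeff k 1 * w 1) *\<^sub>R u 1 z
        + (\<Sum>j=1..n. ((real j + 1 - 2 * real k) * acoeff k (Suc j) * w (Suc j)) *\<^sub>R u (Suc j) z)"
    unfolding k sum_head by (simp add: algebra_simps)
  \<comment> \<open>The lowest, interior and highest terms match by \<open>acoeff_first\<close>,
    \<open>acoeff_rec\<close> and \<open>acoeff_diag\<close> respectively.\<close>
  also have "(\<Sum>j=1..n. (acoeff k j * w (Suc j)) *\<^sub>R u (Suc j) z) + w (Suc k) *\<^sub>R u (Suc k) z
      + (((1 - 2 * real k) * acoeff k 1 * w 1) *\<^sub>R u 1 z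
        + (\<Sum>j=1..n. ((real j + 1 - 2 * real k) * acoeff k (Suc j) * w (Suc j)) *\<^sub>R u (Suc j) z))
      = (acoeff (Suc k) 1 * w 1) *\<^sub>R u 1 z
        + ((\<Sum>j=1..n. (acoeff (Suc k) (Suc j) * w (Suc j)) *\<^sub>R u (Suc j) z)
        + (acoeff (Suc k) (Suc k) * w (Suc k)) *\<^sub>R u (Suc k) z)"
  proof -
    have "(\<Sum>j=1..n. (acoeff (Suc k) (Suc j) * w (Suc j)) *\<^sub>R u (Suc j) z)
       = (\<Sum>j=1..n. (acoeff k j * w (Suc j)) *\<^sub>R u (Suc j) z)
        + (\<Sum>j=1..n. ((real j + 1 - 2 * real k) * acoeff k (Suc j) * w (Suc j)) *\<^sub>R u (Suc j) z)"
      unfolding sum.distrib[symmetric]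
      by (intro sum.cong refl) (subst acoeff_rec, auto simp: k algebra_simps)
    then show ?thesis
      using acoeff_first[OF \<open>k \<ge> 1\<close>] by (simp add: acoeff_diag)
  qed
  also have "\<dots> = (\<Sum>j=1..Suc k. (acoeff (Suc k) j * w j) *\<^sub>R u j z)"
    unfolding sum_head[of _ k] by (simp add: k)
  also have "\<dots> = Im z *\<^sub>R weighted_sum (Suc k) u z"
  proof -
    have "w j = b * b powi (int j - 2 * int (Suc k))" for j
      using z power_int_add[of b 1 "int j - 2 * int (Suc k)"] by (simp add: w_def b_def algebra_simps)
    then show ?thesis
      by (simp add: weighted_sum_def scaleR_sum_right b_def mult_ac del: sum.cl_ivl_Suc)
  qed
  finally show ?thesis by (simp add: weighted_sum_def[abs_def])
qed

section \<open>Intrinsic holomorphic functions\<close>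

text \<open>This is a real-valued regular stem function in complex form: parity becomes
  compatibility with conjugation, and the Cauchy-Riemann equations become holomorphy.\<close>

definition intrinsic_on :: "complex set \<Rightarrow> (complex \<Rightarrow> complex) \<Rightarrow> bool" where
  "intrinsic_on D h \<longleftrightarrow> h holomorphic_on D \<and> (\<forall>z\<in>D. cnj z \<in> D \<and> h (cnj z) = cnj (h z))"

text \<open>The function \<open>cnj \<circ> h \<circ> cnj\<close> agrees with \<open>h\<close> on
  \<open>D\<close>, and its derivative is the conjugate of \<open>deriv h\<close> at the conjugate
  point.\<close>

lemma intrinsic_on_deriv:
  assumes "open D" and h: "intrinsic_on D h"
  shows "intrinsic_on D (deriv h)"
  unfolding intrinsic_on_def
proof (intro conjI ballI)
  show "deriv h holomorphic_on D"
    using h \<open>open D\<close> by (auto simp: intrinsic_on_def intro: holomorphic_deriv)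
  fix z assume z: "z \<in> D"
  then show c: "cnj z \<in> D" using h by (simp add: intrinsic_on_def)
  have "(h has_field_derivative deriv h (cnj z)) (at (cnj z))"
    using h c \<open>open D\<close> by (auto simp: intrinsic_on_def intro: holomorphic_derivI)
  then have "((cnj \<circ> h \<circ> cnj) has_field_derivative cnj (deriv h (cnj z))) (at z)"
    by (rule has_field_derivative_cnj_cnj)
  then have "(h has_field_derivative cnj (deriv h (cnj z))) (at z)"
    by (rule has_field_derivative_transform_within_open[OF _ \<open>open D\<close> z])
      (use h in \<open>auto simp: intrinsic_on_def\<close>)
  then show "deriv h (cnj z) = cnj (deriv h z)"
    using DERIV_imp_deriv by fastforce
qed

lemma intrinsic_on_higher_deriv:
  "open D \<Longrightarrow> intrinsic_on D h \<Longrightarrow> intrinsic_on D ((deriv ^^ n) h)"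
  by (induction n) (simp_all add: intrinsic_on_deriv)

lemma intrinsic_on_real:
  assumes "intrinsic_on D h" "z \<in> D" "Im z = 0"
  shows "h z = complex_of_real (Re (h z))"
proof -
  have "cnj z = z" using assms by (simp add: complex_eq_iff)
  then have "h z = cnj (h z)" using assms by (metis intrinsic_on_def)
  then show ?thesis by (simp add: complex_eq_iff)
qed

lemma has_dir_deriv_holomorphic:
  assumes "h holomorphic_on D" "open D" "z \<in> D"
  shows "has_dir_deriv h (deriv h z * v) v z"
proof -
  have "(h has_derivative (*) (deriv h z)) (at z)"
    using holomorphic_derivI[OF assms(1,2,3)] by (simp add: has_field_derivative_def)
  from has_derivative_imp_has_dir_deriv[OF this] show ?thesis by simp
qed

text \<open>For holomorphic \<open>h\<close> this is \<open>\<partial>\<^sub>\<beta>\<^sup>l (Im h)\<close>, because \<open>\<partial>\<^sub>\<beta> h = \<i> h'\<close>.\<close>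

definition deriv_Im :: "(complex \<Rightarrow> complex) \<Rightarrow> nat \<Rightarrow> complex \<Rightarrow> real" where
  "deriv_Im h l z = Im (\<i> ^ l * (deriv ^^ l) h z)"

lemma deriv_Im_0: "deriv_Im h 0 z = Im (h z)"
  by (simp add: deriv_Im_def)

lemma has_dir_deriv_deriv_Im:
  assumes "h holomorphic_on D" "open D" "z \<in> D"
  shows "has_dir_deriv (deriv_Im h l) (deriv_Im h (Suc l) z) \<i> z"
    and "has_dir_deriv (deriv_Im h l) (deriv_Im (deriv h) l z) 1 z"
proof -
  have "has_dir_deriv ((deriv ^^ l) h) (deriv ((deriv ^^ l) h) z * v) v z" for v
    using assms by (intro has_dir_deriv_holomorphic[of _ D] holomorphic_higher_deriv)
  then have "has_dir_deriv (\<lambda>z. Im (\<i> ^ l * (deriv ^^ l) h z))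
      (Im (\<i> ^ l * (deriv ((deriv ^^ l) h) z * v))) v z" for v
    by (intro has_dir_deriv_linear[OF bounded_linear_Im]
        has_dir_deriv_linear[OF bounded_linear_mult_right])
  from this[of \<i>] this[of 1]
  show "has_dir_deriv (deriv_Im h l) (deriv_Im h (Suc l) z) \<i> z"
    and "has_dir_deriv (deriv_Im h l) (deriv_Im (deriv h) l z) 1 z"
    unfolding deriv_Im_def[abs_def]
    by (simp_all add: mult_ac funpow_swap1)
qed

section \<open>The spherical derivative and its iterates\<close>

text \<open>
  This is \<open>(\<beta>\<^sup>-\<^sup>1 \<partial>\<^sub>\<beta>)\<^sup>k (\<beta>\<^sup>-\<^sup>1 Im h)\<close>, together with its continuous extension
  to the real axis, which is read off from the power series of \<open>h\<close> at a real point.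
  Off the axis, \<open>\<beta>\<^sup>-\<^sup>1 Im h\<close> is treated as \<open>\<beta>\<^sup>-\<^sup>1 \<partial>\<^sub>\<beta>\<close> of a primitive of \<open>Im h\<close>; hence
  \<open>Suc k\<close> and the index shift \<open>j - 1\<close>.
\<close>

definition sph :: "(complex \<Rightarrow> complex) \<Rightarrow> nat \<Rightarrow> complex \<Rightarrow> real" where
  "sph h k z = (if Im z = 0
     then (- 2) ^ k * fact k / fact (2 * k + 1) * Re ((deriv ^^ (2 * k + 1)) h z)
     else weighted_sum (Suc k) (\<lambda>j. deriv_Im h (j - 1)) z)"

lemma sph_0: "Im z \<noteq> 0 \<Longrightarrow> sph h 0 z = Im (h z) / Im z"
  by (simp add: sph_def weighted_sum_def acoeff_def deriv_Im_0 power_int_minus field_simps)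

lemma has_dir_deriv_off_real:
  assumes "has_dir_deriv g g' v z" and "Im z \<noteq> 0" and "\<And>z. Im z \<noteq> 0 \<Longrightarrow> g z = k z"
  shows "has_dir_deriv k g' v z"
  by (rule has_dir_deriv_cong[OF assms(1) open_Im_nonzero]) (use assms in auto)

lemma has_dir_deriv_sph_off_real:
  assumes "h holomorphic_on D" "open D" "z \<in> D" "Im z \<noteq> 0"
  shows "has_dir_deriv (sph h k) (Im z *\<^sub>R sph h (Suc k) z) \<i> z"
    and "has_dir_deriv (sph h k) (sph (deriv h) k z) 1 z"
proof -
  have "has_dir_deriv (weighted_sum (Suc k) (\<lambda>j. deriv_Im h (j - 1)))
      (Im z *\<^sub>R weighted_sum (Suc (Suc k)) (\<lambda>j. deriv_Im h (j - 1)) z) \<i> z"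
  proof (rule weighted_sum_beta)
    fix j :: nat assume "j \<ge> 1"
    then show "has_dir_deriv (deriv_Im h (j - 1)) (deriv_Im h (Suc j - 1) z) \<i> z"
      using has_dir_deriv_deriv_Im(1)[OF assms(1-3), of "j - 1"] by simp
  qed (use assms in auto)
  from has_dir_deriv_off_real[OF this, of "sph h k"] assms(4)
  show "has_dir_deriv (sph h k) (Im z *\<^sub>R sph h (Suc k) z) \<i> z"
    by (simp add: sph_def)
  have "has_dir_deriv (weighted_sum (Suc k) (\<lambda>j. deriv_Im h (j - 1)))
      (weighted_sum (Suc k) (\<lambda>j. deriv_Im (deriv h) (j - 1)) z) 1 z"
    using assms by (intro weighted_sum_alpha has_dir_deriv_deriv_Im(2))
  from has_dir_deriv_off_real[OF this, of "sph h k"] assms(4)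
  show "has_dir_deriv (sph h k) (sph (deriv h) k z) 1 z"
    by (simp add: sph_def)
qed

lemma power_odd: "x ^ (2 * n + 1) = x * (x\<^sup>2) ^ n" for x :: "'a::monoid_mult"
  by (simp add: power_mult)

text \<open>Used at n = 0, where it gives the k-th derivative of a power series at the origin;
  general \<open>n\<close> serves the induction.\<close>

lemma diffs_funpow_0: "(diffs ^^ k) c n * fact n = fact (n + k) * (c (n + k) :: real)"
proof (induction k arbitrary: n)
  case (Suc k)
  have "(diffs ^^ Suc k) c n * fact n = (diffs ^^ k) c (Suc n) * fact (Suc n)"
    by (simp add: diffs_def mult_ac)
  then show ?case by (simp only: Suc.IH add_Suc add_Suc_right)
qed simp

text \<open>
  On a vertical line through a real point, \<open>sph h k\<close> is an even function of \<open>\<beta>\<close>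
  and in fact a convergent power series in \<open>\<beta>\<^sup>2\<close>.
\<close>

lemma sph_power_series:
  assumes "open D" and h: "intrinsic_on D h" and z: "z \<in> D" "Im z = 0"
  obtains r \<psi> where "r > 0"
    and "\<And>k s. \<bar>s\<bar> < r\<^sup>2 \<Longrightarrow> (\<psi> k has_real_derivative \<psi> (Suc k) s) (at s)"
    and "\<And>k t. \<bar>t\<bar> < r \<Longrightarrow> sph h k (z + t *\<^sub>R \<i>) = 2 ^ k * \<psi> k (t\<^sup>2)"
proof -
  obtain r where r: "r > 0" "ball z r \<subseteq> D" using \<open>open D\<close> z(1) open_contains_ball by blast
  define a where "a n = Re ((deriv ^^ n) h z) / fact n" for n
  \<comment> \<open>The term of order 2n + 1 of the Taylor series contributes (i t)^(2n+1) = i t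
    (-1)^n (t^2)^n, so \<open>d\<close> collects the coefficients of Im h / t in powers of
    t^2.\<close>
  define d where "d n = (- 1) ^ n * a (2 * n + 1)" for n
  define \<psi> where "\<psi> k s = (\<Sum>n. (diffs ^^ k) d n * s ^ n)" for k and s :: real
  have coeff: "(deriv ^^ n) h z / fact n = of_real (a n)" for n
    using intrinsic_on_real[OF intrinsic_on_higher_deriv[OF \<open>open D\<close> h, of n] z]
    by (metis a_def of_real_divide of_real_fact)
  \<comment> \<open>At a real point all Taylor coefficients \<open>a n\<close> are real, so even
    powers of i t have no imaginary part.\<close>
  have ser: "(\<lambda>n. d n * (t\<^sup>2) ^ n) sums (Im (h (z + t *\<^sub>R \<i>)) / t)" if t: "\<bar>t\<bar> < r" "t \<noteq> 0" for t
  proof -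
    define f where "f n = Im (of_real (a n) * (of_real t * \<i>) ^ n)" for n
    have "h holomorphic_on ball z r" using h r by (auto simp: intrinsic_on_def intro: holomorphic_on_subset)
    moreover have "z + t *\<^sub>R \<i> \<in> ball z r" using t by (simp add: dist_norm)
    ultimately have "(\<lambda>n. (deriv ^^ n) h z / fact n * (z + t *\<^sub>R \<i> - z) ^ n) sums h (z + t *\<^sub>R \<i>)"
      by (rule holomorphic_power_series)
    then have "f sums Im (h (z + t *\<^sub>R \<i>))"
      unfolding coeff f_def by (intro sums_Im) (simp add: scaleR_conv_of_real)
    moreover have "f n = 0" if "n \<notin> range (\<lambda>n. 2 * n + 1)" for n
    proof -
      have "even n"
      proof (rule ccontr)
        assume "odd n"
        then obtain m where "n = 2 * m + 1" by (rule oddE)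
        with that show False by blast
      qed
      then obtain m where "n = 2 * m" by blast
      then have "f n = Im (of_real (a n * (- (t\<^sup>2)) ^ m))"
        by (simp add: f_def power_mult power_mult_distrib flip: of_real_power)
      then show ?thesis by simp
    qed
    moreover have "strict_mono (\<lambda>n. 2 * n + 1 :: nat)" by (simp add: strict_mono_def)
    ultimately have "(\<lambda>n. f (2 * n + 1)) sums Im (h (z + t *\<^sub>R \<i>))"
      by (subst sums_mono_reindex)
    moreover have "f (2 * n + 1) = t * (d n * (t\<^sup>2) ^ n)" for n
    proof -
      have "(of_real t * \<i>)\<^sup>2 = of_real (- (t\<^sup>2))" by (simp add: power_mult_distrib)
      then have "(of_real t * \<i>) ^ (2 * n + 1) = of_real t * \<i> * of_real (- (t\<^sup>2)) ^ n"
        by (simp only: power_odd)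
      also have "\<dots> = of_real (t * (- (t\<^sup>2)) ^ n) * \<i>"
        by (simp only: of_real_mult of_real_power mult.assoc mult.commute[of \<i>])
      finally have pw: "(of_real t * \<i>) ^ (2 * n + 1) = of_real (t * (- (t\<^sup>2)) ^ n) * \<i>" .
      have "f (2 * n + 1) = Im (of_real (a (2 * n + 1)) * (of_real (t * (- (t\<^sup>2)) ^ n) * \<i>))"
        by (simp only: f_def pw)
      also have "\<dots> = a (2 * n + 1) * (t * (- (t\<^sup>2)) ^ n)"
        by (simp only: Im_complex_of_real Re_complex_of_real times_complex.sel) simp
      also have "(- (t\<^sup>2)) ^ n = (- 1) ^ n * (t\<^sup>2) ^ n" by (rule power_minus)
      finally show ?thesis by (simp add: d_def mult_ac)
    qed
    ultimately have "(\<lambda>n. t * (d n * (t\<^sup>2) ^ n)) sums Im (h (z + t *\<^sub>R \<i>))" by simp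
    from sums_divide[OF this, of t] t(2) show ?thesis by simp
  qed
  have summ: "summable (\<lambda>n. (diffs ^^ k) d n * s ^ n)" if "\<bar>s\<bar> < r\<^sup>2" for k s
    using that
  proof (induction k arbitrary: s)
    case 0
    \<comment> \<open>t^2 is the midpoint of |s| and r^2: the series converges there, hence
      absolutely at the smaller \<open>s\<close>.\<close>
    define t where "t = sqrt ((\<bar>s\<bar> + r\<^sup>2) / 2)"
    have t2: "t\<^sup>2 = (\<bar>s\<bar> + r\<^sup>2) / 2" by (simp add: t_def)
    have "t > 0" using r by (simp add: t_def add_nonneg_pos)
    moreover have "t < r"
      by (rule power2_less_imp_less) (use 0 r in \<open>auto simp: t2\<close>)
    ultimately have "summable (\<lambda>n. d n * (t\<^sup>2) ^ n)" using ser[of t] by (auto simp: sums_iff)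
    then have "summable (\<lambda>n. d n * s ^ n)" by (rule powser_inside) (use 0 in \<open>auto simp: t2\<close>)
    then show ?case by simp
  next
    case (Suc k)
    have "summable (\<lambda>n. diffs ((diffs ^^ k) d) n * s ^ n)"
      by (rule termdiff_converges[of s "r\<^sup>2"]) (use Suc in auto)
    then show ?case by simp
  qed
  have der: "(\<psi> k has_real_derivative \<psi> (Suc k) s) (at s)" if "\<bar>s\<bar> < r\<^sup>2" for k s
  proof -
    have "\<bar>(\<bar>s\<bar> + r\<^sup>2) / 2\<bar> < r\<^sup>2" "\<bar>s\<bar> < \<bar>(\<bar>s\<bar> + r\<^sup>2) / 2\<bar>" using that by auto
    with termdiffs_strong[OF summ, of "(\<bar>s\<bar> + r\<^sup>2) / 2" s k]
    show ?thesis unfolding \<psi>_def by simp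
  qed
  \<comment> \<open>On functions of s = \<beta>^2 the operator \<beta>^(-1) d/d\<beta> is 2 d/ds,
    whence the factor 2^k. The induction compares two values of one derivative and cancels
    \<open>t\<close>.\<close>
  have off: "sph h k (z + t *\<^sub>R \<i>) = 2 ^ k * \<psi> k (t\<^sup>2)" if "\<bar>t\<bar> < r" "t \<noteq> 0" for k t
    using that
  proof (induction k arbitrary: t)
    case 0
    with ser[of t] z show ?case by (simp add: sph_0 \<psi>_def sums_iff)
  next
    case (Suc k)
    define w where "w = z + t *\<^sub>R \<i>"
    have w: "w \<in> D" "Im w = t"
      using r Suc.prems z by (auto simp: w_def dist_norm subset_iff)
    have t2: "t\<^sup>2 < r\<^sup>2" using power_strict_mono[of "\<bar>t\<bar>" r 2] Suc.prems by simp
    have "((\<lambda>s. 2 ^ k * \<psi> k ((t + s)\<^sup>2)) has_real_derivative 2 ^ k * (\<psi> (Suc k) (t\<^sup>2) * (2 * t))) (at 0)"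
      using t2 by (auto intro!: derivative_eq_intros DERIV_chain2[OF der])
    then have "((\<lambda>s. 2 ^ k * \<psi> k ((t + s)\<^sup>2)) has_vector_derivative 2 ^ k * (\<psi> (Suc k) (t\<^sup>2) * (2 * t))) (at 0)"
      by (simp add: has_real_derivative_iff_has_vector_derivative)
    then have "((\<lambda>s. sph h k (w + s *\<^sub>R \<i>)) has_vector_derivative 2 ^ k * (\<psi> (Suc k) (t\<^sup>2) * (2 * t))) (at 0)"
    proof (rule has_vector_derivative_transform_within_open)
      show "open {s. \<bar>t + s\<bar> < r \<and> t + s \<noteq> 0}"
        by (intro open_Collect_conj open_Collect_less open_Collect_neq continuous_intros)
      show "2 ^ k * \<psi> k ((t + s)\<^sup>2) = sph h k (w + s *\<^sub>R \<i>)" if "s \<in> {s. \<bar>t + s\<bar> < r \<and> t + s \<noteq> 0}" for s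
        using Suc.IH[of "t + s"] that by (simp add: w_def algebra_simps)
    qed (use Suc.prems in auto)
    then have "has_dir_deriv (sph h k) (2 ^ k * (\<psi> (Suc k) (t\<^sup>2) * (2 * t))) \<i> w"
      by (simp add: has_dir_deriv_def)
    moreover have "has_dir_deriv (sph h k) (Im w *\<^sub>R sph h (Suc k) w) \<i> w"
      using h \<open>open D\<close> w Suc.prems
      by (intro has_dir_deriv_sph_off_real[of _ D]) (auto simp: intrinsic_on_def)
    ultimately have "t * sph h (Suc k) w = 2 ^ k * (\<psi> (Suc k) (t\<^sup>2) * (2 * t))"
      using has_dir_deriv_unique w by fastforce
    then show ?case using Suc.prems by (simp add: w_def)
  qed
  \<comment> \<open>At t = 0 the k-th derivative of the series is k! d_k, which is how the constant
    in the real branch of \<open>sph\<close> arises.\<close>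
  have "sph h k z = 2 ^ k * \<psi> k 0" for k
  proof -
    have "\<psi> k 0 = (diffs ^^ k) d 0" by (simp add: \<psi>_def)
    then have "\<psi> k 0 = fact k * d k" using diffs_funpow_0[of k d 0] by simp
    moreover have "(- 2 :: real) ^ k = 2 ^ k * (- 1) ^ k" by (simp flip: power_mult_distrib)
    ultimately show ?thesis using z by (simp add: sph_def d_def a_def)
  qed
  then have "sph h k (z + t *\<^sub>R \<i>) = 2 ^ k * \<psi> k (t\<^sup>2)" if "\<bar>t\<bar> < r" for k t
    using off[OF that] by (cases "t = 0") simp_all
  with der r show ?thesis using that by blast
qed

text \<open>At a real point \<open>sph h k\<close> is a differentiable function of t^2 along the
  vertical line, so its derivative is 0, as is the factor \<open>Im z\<close>.\<close>

lemma has_dir_deriv_sph_beta: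
  assumes "open D" and h: "intrinsic_on D h" and z: "z \<in> D"
  shows "has_dir_deriv (sph h k) (Im z *\<^sub>R sph h (Suc k) z) \<i> z"
proof (cases "Im z = 0")
  case True
  obtain r \<psi> where r: "r > 0"
    and der: "\<And>k s. \<bar>s\<bar> < r\<^sup>2 \<Longrightarrow> (\<psi> k has_real_derivative \<psi> (Suc k) s) (at s)"
    and eq: "\<And>k t. \<bar>t\<bar> < r \<Longrightarrow> sph h k (z + t *\<^sub>R \<i>) = 2 ^ k * \<psi> k (t\<^sup>2)"
    using sph_power_series[OF assms True] by metis
  have "((\<lambda>t. 2 ^ k * \<psi> k (t\<^sup>2)) has_real_derivative 0) (at 0)"
    using r by (auto intro!: derivative_eq_intros DERIV_chain2[OF der])
  then have "((\<lambda>t. 2 ^ k * \<psi> k (t\<^sup>2)) has_vector_derivative 0) (at 0)"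
    by (simp add: has_real_derivative_iff_has_vector_derivative)
  then have "((\<lambda>t. sph h k (z + t *\<^sub>R \<i>)) has_vector_derivative 0) (at 0)"
    by (rule has_vector_derivative_transform_within_open[of _ _ _ "{- r<..<r}"])
      (use r eq in auto)
  then show ?thesis using True by (simp add: has_dir_deriv_def)
next
  case False
  then show ?thesis using assms
    by (intro has_dir_deriv_sph_off_real[of _ D]) (auto simp: intrinsic_on_def)
qed

text \<open>The real direction preserves \<open>Im z\<close>, so at a real point only the
  Taylor-coefficient branch of \<open>sph\<close> is differentiated.\<close>

lemma has_dir_deriv_sph_alpha:
  assumes "open D" and h: "h holomorphic_on D" and z: "z \<in> D"
  shows "has_dir_deriv (sph h k) (sph (deriv h) k z) 1 z"
proof (cases "Im z = 0")
  case True
  define c :: real where "c = (- 2) ^ k * fact k / fact (2 * k + 1)"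
  have "has_dir_deriv (\<lambda>z. c *\<^sub>R Re ((deriv ^^ (2 * k + 1)) h z))
      (c *\<^sub>R Re (deriv ((deriv ^^ (2 * k + 1)) h) z * 1)) 1 z"
    using assms by (intro has_dir_deriv_scaleR_const has_dir_deriv_linear[OF bounded_linear_Re]
        has_dir_deriv_holomorphic[of _ D] holomorphic_higher_deriv)
  then show ?thesis
    using True unfolding has_dir_deriv_def by (simp add: sph_def c_def funpow_swap1)
next
  case False
  then show ?thesis using assms by (intro has_dir_deriv_sph_off_real[of _ D])
qed

section \<open>Relations between successive iterates\<close>

lemma Im_sph_0:
  assumes "intrinsic_on D h" "z \<in> D"
  shows "Im (h z) = Im z * sph h 0 z"
  using assms intrinsic_on_real[OF assms] by (cases "Im z = 0") (auto simp: sph_0 dest: arg_cong[where f = Im])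

lemma sph_1: "Im z \<noteq> 0 \<Longrightarrow> (Im z)\<^sup>2 * sph h 1 z = Re (deriv h z) - sph h 0 z"
  by (simp add: sph_def weighted_sum_def acoeff_def deriv_Im_def power_int_minus eval_nat_numeral field_simps)

text \<open>With u = Im h, the terms \<beta>^2 \<open>sph h 2\<close> + 3 \<open>sph h 1\<close>
  collapse to u''/\<beta> (primes for d/d\<beta>), and u'' = - Im h'' since i^2 = -1.\<close>

lemma sph_ode_0:
  assumes "Im z \<noteq> 0"
  shows "sph (deriv (deriv h)) 0 z + (Im z)\<^sup>2 * sph h 2 z + 3 * sph h 1 z = 0"
proof -
  have p: "Im z powi (- 5) = 1 / Im z ^ 5" "Im z powi (- 4) = 1 / Im z ^ 4"
    "Im z powi (- 3) = 1 / Im z ^ 3" "Im z powi (- 2) = 1 / Im z ^ 2" "Im z powi (- 1) = 1 / Im z"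
    by (simp_all add: power_int_minus divide_inverse)
  show ?thesis using assms
    by (simp add: sph_def weighted_sum_def acoeff_def deriv_Im_def p eval_nat_numeral)
      (simp add: field_simps)
qed

text \<open>Off the axis, apply \<beta>^(-1) d/d\<beta> inductively: on \<beta>^2 g it gives
  \<beta>^2 times the image of g, plus 2 g, so the constant grows by 2. On the axis the \<beta>^2
  term drops out and Taylor coefficients are compared.\<close>

lemma sph_ode:
  assumes "open D" and h: "intrinsic_on D h" and z: "z \<in> D"
  shows "sph (deriv (deriv h)) k z + (Im z)\<^sup>2 * sph h (k + 2) z + (2 * real k + 3) * sph h (k + 1) z = 0"
proof (cases "Im z = 0")
  case True
  define c :: real where "c = (- 2) ^ k * fact k / fact (2 * k + 1)"
  define R where "R = Re ((deriv ^^ (2 * k + 3)) h z)"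
  have "(deriv ^^ (2 * k + 1)) (deriv (deriv h)) = (deriv ^^ (2 * k + 3)) h"
    by (simp add: funpow_swap1 eval_nat_numeral)
  then have "sph (deriv (deriv h)) k z = c * R"
    by (simp only: sph_def c_def R_def True simp_thms if_True)
  \<comment> \<open>Passing from k to k + 1 multiplies the constant by -2 (k + 1) / ((2k + 3)(2k +
    2)) = -1 / (2k + 3).\<close>
  moreover have "sph h (k + 1) z = - c / (2 * real k + 3) * R"
  proof -
    have "(fact (2 * k + 3) :: real) = (2 * real k + 3) * (2 * (real k + 1)) * fact (2 * k + 1)"
      using fact_add_2[of "2 * k + 1"] by (simp add: eval_nat_numeral add_ac)
    moreover have "(fact (k + 1) :: real) = (real k + 1) * fact k" by simp
    moreover have "2 * (k + 1) + 1 = 2 * k + 3" by simp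
    moreover have "real k + 1 \<noteq> 0" "2 * real k + 3 \<noteq> 0" by linarith+
    ultimately show ?thesis using True
      by (simp only: sph_def c_def R_def if_True power_add) (simp add: divide_simps del: fact_Suc)
  qed
  moreover have "2 * real k + 3 \<noteq> 0" by linarith
  ultimately show ?thesis using True by simp
next
  case False
  with z show ?thesis
  proof (induction k arbitrary: z)
    case 0
    then show ?case using sph_ode_0[of z h] by (simp add: numeral_2_eq_2)
  next
    case (Suc k)
    \<comment> \<open>\<open>E\<close> vanishes on the open set \<open>D\<close> minus the real
      line, so its \<beta>-derivative there is 0.\<close>
    define E where "E z = sph (deriv (deriv h)) k z + Im z powi 2 *\<^sub>R sph h (k + 2) z
      + (2 * real k + 3) *\<^sub>R sph h (k + 1) z" for z
    have h2: "intrinsic_on D (deriv (deriv h))" using \<open>open D\<close> h by (intro intrinsic_on_deriv)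
    have "has_dir_deriv E (Im z *\<^sub>R sph (deriv (deriv h)) (Suc k) z
       + (Im z powi 2 *\<^sub>R (Im z *\<^sub>R sph h (Suc (k + 2)) z) + (of_int 2 * Im z powi (2 - 1)) *\<^sub>R sph h (k + 2) z)
       + (2 * real k + 3) *\<^sub>R (Im z *\<^sub>R sph h (Suc (k + 1)) z)) \<i> z"
      unfolding E_def[abs_def] using Suc.prems \<open>open D\<close> h h2
      by (intro has_dir_deriv_add has_dir_deriv_scaleR has_dir_deriv_scaleR_const
          has_dir_deriv_sph_beta[of D] has_dir_deriv_Im_powi)
    moreover have "has_dir_deriv E 0 \<i> z"
    proof (rule has_dir_deriv_cong[OF has_dir_deriv_const])
      show "open (D \<inter> {z. Im z \<noteq> 0})" using \<open>open D\<close> open_Im_nonzero by blast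
    qed (use Suc in \<open>auto simp: E_def power_int_def\<close>)
    ultimately have "Im z * (sph (deriv (deriv h)) (Suc k) z + (Im z)\<^sup>2 * sph h (Suc k + 2) z
      + (2 * real (Suc k) + 3) * sph h (Suc k + 1) z) = 0"
      using has_dir_deriv_unique by (fastforce simp: algebra_simps power_int_def)
    then show ?case using Suc.prems by simp
  qed
qed

section \<open>Iterated \<beta>-derivatives of the spherical derivative\<close>

text \<open>
  The \<open>\<beta>\<close>-derivatives of \<open>\<beta>\<^sup>-\<^sup>1 Im h\<close>; the recursion is the Leibniz rule for
  the product of \<open>\<beta>\<close> and \<open>\<beta>\<^sup>-\<^sup>1 Im h\<close>.
\<close>

primrec deriv_sph :: "(complex \<Rightarrow> complex) \<Rightarrow> nat \<Rightarrow> complex \<Rightarrow> real" where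
  "deriv_sph h 0 z = Im (h z) / Im z"
| "deriv_sph h (Suc l) z = (deriv_Im h (Suc l) z - real (Suc l) * deriv_sph h l z) / Im z"

lemma has_dir_deriv_deriv_sph_step:
  assumes z: "Im z \<noteq> 0" and "has_dir_deriv b b' v z" "has_dir_deriv s s' v z" "has_dir_deriv (\<lambda>z. Im z powi (- 1)) p v z"
  shows "has_dir_deriv (\<lambda>z. (b z - c * s z) / Im z) ((b' - c * s') / Im z + p * (b z - c * s z)) v z"
proof -
  have "has_dir_deriv (\<lambda>z. Im z powi (- 1) *\<^sub>R (b z + (- c) *\<^sub>R s z))
    (Im z powi (- 1) *\<^sub>R (b' + (- c) *\<^sub>R s') + p *\<^sub>R (b z + (- c) *\<^sub>R s z)) v z"
    by (intro has_dir_deriv_scaleR has_dir_deriv_add has_dir_deriv_scaleR_const assms)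
  then show ?thesis by (simp add: power_int_minus divide_inverse mult_ac)
qed

text \<open>Differentiating the recursion, the factor 1 / Im z contributes one further copy of the
  current derivative divided by -Im z, which raises the multiplier \<open>real (Suc l)\<close> by
  one.\<close>

lemma has_dir_deriv_deriv_sph:
  assumes "h holomorphic_on D" "open D" "z \<in> D" "Im z \<noteq> 0"
  shows "has_dir_deriv (deriv_sph h l) (deriv_sph h (Suc l) z) \<i> z"
    and "has_dir_deriv (deriv_sph h l) (deriv_sph (deriv h) l z) 1 z"
proof -
  have p: "has_dir_deriv (\<lambda>z. Im z powi (- 1)) (- 1 / (Im z)\<^sup>2) \<i> z"
    "has_dir_deriv (\<lambda>z. Im z powi (- 1)) 0 1 z"
    using has_dir_deriv_Im_powi[OF assms(4), of "- 1"] assms(4)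
    by (simp_all add: power_int_minus divide_inverse)
  note d = has_dir_deriv_deriv_Im[OF assms(1,2,3)]
  \<comment> \<open>This puts the base case into the shape of the recursive one.\<close>
  have zero: "deriv_sph h 0 = (\<lambda>z. (deriv_Im h 0 z - 0 * (0::real)) / Im z)" for h
    by (simp add: fun_eq_iff deriv_Im_0)
  show "has_dir_deriv (deriv_sph h l) (deriv_sph h (Suc l) z) \<i> z"
  proof (induction l)
    case 0
    have "has_dir_deriv (deriv_sph h 0) ((deriv_Im h (Suc 0) z - 0 * 0) / Im z
        + - 1 / (Im z)\<^sup>2 * (deriv_Im h 0 z - 0 * 0)) \<i> z"
      unfolding zero
      by (rule has_dir_deriv_deriv_sph_step[OF assms(4) d(1) has_dir_deriv_const p(1)])
    moreover have "(deriv_Im h (Suc 0) z - 0 * 0) / Im z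
        + - 1 / (Im z)\<^sup>2 * (deriv_Im h 0 z - 0 * 0) = deriv_sph h (Suc 0) z"
      using assms(4) by (simp add: deriv_Im_0 field_simps power2_eq_square)
    ultimately show ?case by (simp only:)
  next
    case (Suc l)
    have suc: "deriv_sph h (Suc l) = (\<lambda>z. (deriv_Im h (Suc l) z - real (Suc l) * deriv_sph h l z) / Im z)"
      by (simp add: fun_eq_iff)
    have "has_dir_deriv (deriv_sph h (Suc l)) ((deriv_Im h (Suc (Suc l)) z - real (Suc l) * deriv_sph h (Suc l) z) / Im z
        + - 1 / (Im z)\<^sup>2 * (deriv_Im h (Suc l) z - real (Suc l) * deriv_sph h l z)) \<i> z"
      using has_dir_deriv_deriv_sph_step[OF assms(4) d(1)[of "Suc l"] Suc p(1), of "real (Suc l)"]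
      by (simp only: suc)
    moreover have "(deriv_Im h (Suc (Suc l)) z - real (Suc l) * deriv_sph h (Suc l) z) / Im z
        + - 1 / (Im z)\<^sup>2 * (deriv_Im h (Suc l) z - real (Suc l) * deriv_sph h l z)
        = deriv_sph h (Suc (Suc l)) z"
      using assms(4) by (simp add: field_simps power2_eq_square)
    ultimately show ?case by (simp only:)
  qed
  show "has_dir_deriv (deriv_sph h l) (deriv_sph (deriv h) l z) 1 z"
  proof (induction l)
    case 0
    show ?case
      using has_dir_deriv_deriv_sph_step[OF assms(4) d(2)[of 0] has_dir_deriv_const p(2), of 0 0]
      by (simp add: zero del: deriv_sph.simps(1))
  next
    case (Suc l)
    show ?case
      using has_dir_deriv_deriv_sph_step[OF assms(4) d(2)[of "Suc l"] Suc p(2), of "real (Suc l)"]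
      by simp
  qed
qed

text \<open>This links the two displayed formulas: the k-th iterate is expanded in derivatives of
  \<open>Im h / Im z\<close> on the left and of \<open>Im h\<close> on the right. Both sides have
  the same \<beta>-derivative, which drives the induction; k = 0 would give an empty sum on the
  left.\<close>

lemma weighted_sum_deriv_sph:
  assumes "intrinsic_on D h" "open D" "z \<in> D" "Im z \<noteq> 0" "k \<ge> 1"
  shows "weighted_sum k (deriv_sph h) z = sph h k z"
  using assms(5,3,4)
proof (induction k arbitrary: z rule: nat_induct_at_least)
  case base
  have "weighted_sum 1 (deriv_sph h) z = (Re (deriv h z) - sph h 0 z) / (Im z)\<^sup>2"
    using base by (simp add: weighted_sum_def acoeff_def power_int_minus deriv_Im_def sph_0
        field_simps power2_eq_square)
  then show ?case using base sph_1[of z h] by (simp add: divide_eq_eq mult.commute)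
next
  case (Suc k)
  have hol: "h holomorphic_on D" using assms(1) by (simp add: intrinsic_on_def)
  have "has_dir_deriv (weighted_sum k (deriv_sph h)) (Im z *\<^sub>R weighted_sum (Suc k) (deriv_sph h) z) \<i> z"
    using Suc.hyps Suc.prems hol assms(2)
    by (intro weighted_sum_beta has_dir_deriv_deriv_sph) auto
  moreover have "has_dir_deriv (weighted_sum k (deriv_sph h)) (Im z *\<^sub>R sph h (Suc k) z) \<i> z"
  proof (rule has_dir_deriv_cong[OF has_dir_deriv_sph_beta[OF assms(2,1)]])
    show "open (D \<inter> {z. Im z \<noteq> 0})" using assms(2) open_Im_nonzero by blast
  qed (use Suc in auto)
  ultimately have "Im z *\<^sub>R weighted_sum (Suc k) (deriv_sph h) z = Im z *\<^sub>R sph h (Suc k) z"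
    by (rule has_dir_deriv_unique)
  then show ?case using Suc.prems by simp
qed

section \<open>The Laplacian of slice functions\<close>

lemma bounded_bilinear_cl_mult: "bounded_bilinear (cl_mult :: 'n::{finite,linorder} clifford \<Rightarrow> _)"
  using bilinear_cl_mult bilinear_conv_bounded_bilinear by blast

interpretation cl_mult: bounded_bilinear "cl_mult :: 'n::{finite,linorder} clifford \<Rightarrow> _"
  by (rule bounded_bilinear_cl_mult)

text \<open>This is \<beta> J. Unlike J it is linear in \<open>x\<close>, so products with it can be
  differentiated on the real axis.\<close>

definition vec_part :: "'n::{finite,linorder} paravec \<Rightarrow> 'n clifford" where
  "vec_part x = (\<Sum>i\<in>UNIV. snd x $ i *\<^sub>R cl_gen i)"

lemma para_sgn: "norm (snd x) *\<^sub>R para (0, sgn (snd x)) = vec_part x"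
  by (cases "snd x = 0")
    (simp_all add: para_def vec_part_def sgn_div_norm scaleR_sum_right flip: mult.assoc)

lemma has_dir_deriv_coord:
  "has_dir_deriv (\<lambda>x. snd x $ j) (if j = i then 1 else 0) (0, axis i 1) (x :: 'n::finite paravec)"
  using has_derivative_imp_has_dir_deriv[OF bounded_linear_imp_has_derivative[OF
      bounded_linear_compose[OF bounded_linear_vec_nth bounded_linear_snd]], of j "(0, axis i 1)" x]
  by (simp add: axis_def)

lemma has_dir_deriv_vec_part:
  "has_dir_deriv vec_part (cl_gen i) (0, axis i 1) x" "has_dir_deriv vec_part 0 (1, 0) x"
proof -
  have "has_dir_deriv (\<lambda>x. \<Sum>j\<in>UNIV. snd x $ j *\<^sub>R cl_gen j)
    (\<Sum>j\<in>UNIV. (if j = i then 1 else 0) *\<^sub>R cl_gen j) (0, axis i 1) x"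
    by (intro has_dir_deriv_sum has_dir_deriv_linear[OF bounded_linear_scaleR_left] has_dir_deriv_coord)
  then show "has_dir_deriv vec_part (cl_gen i) (0, axis i 1) x"
    by (simp add: vec_part_def[abs_def] if_distrib[of "\<lambda>c. c *\<^sub>R _"] cong: if_cong)
  show "has_dir_deriv vec_part 0 (1, 0) x"
    by (simp add: vec_part_def has_dir_deriv_def)
qed

lemma laplacian_paravec:
  fixes g :: "'n::finite paravec \<Rightarrow> 'b::real_normed_vector"
  shows "laplacian g x = dir_deriv (1, 0) (dir_deriv (1, 0) g) x
    + (\<Sum>i\<in>UNIV. dir_deriv (0, axis i 1) (dir_deriv (0, axis i 1) g) x)"
proof -
  let ?d = "\<lambda>b. dir_deriv b (dir_deriv b g) x"
  have B: "(Basis :: 'n paravec set) = insert (1, 0) (range (\<lambda>i. (0, axis i 1)))"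
    by (auto simp: Basis_prod_def Basis_vec_def)
  have "inj (\<lambda>i. (0 :: real, axis i (1 :: real)) :: 'n paravec)"
    by (auto simp: inj_on_def axis_eq_axis)
  then have "(\<Sum>b\<in>range (\<lambda>i. (0, axis i 1)). ?d b) = (\<Sum>i\<in>UNIV. ?d (0, axis i 1))"
    by (simp add: sum.reindex)
  then show ?thesis unfolding laplacian_def B by (subst sum.insert) auto
qed

lemma laplacian_cong:
  assumes "open S" "x \<in> S" "\<And>y. y \<in> S \<Longrightarrow> g y = k y"
  shows "laplacian g x = laplacian k x"
  unfolding laplacian_def by (intro sum.cong refl dir_deriv_cong[OF assms(1,2)]) (simp add: dir_deriv_cong[OF assms(1) _ assms(3)])

text \<open>
  For functions of \<open>(\<alpha>, \<beta>)\<close>, a relation \<open>g' = \<beta>\<^sup>-\<^sup>1 \<partial>\<^sub>\<beta> g\<close> that also makes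
  sense on the real axis.
\<close>

definition radial_deriv ::
    "'n::finite paravec set \<Rightarrow> ('n paravec \<Rightarrow> 'b::real_normed_vector) \<Rightarrow> ('n paravec \<Rightarrow> 'b) \<Rightarrow> bool" where
  "radial_deriv S g g' \<longleftrightarrow> (\<forall>x\<in>S. \<forall>i. has_dir_deriv g (snd x $ i *\<^sub>R g' x) (0, axis i 1) x)"

definition axial_deriv ::
    "'n::finite paravec set \<Rightarrow> ('n paravec \<Rightarrow> 'b::real_normed_vector) \<Rightarrow> ('n paravec \<Rightarrow> 'b) \<Rightarrow> bool" where
  "axial_deriv S g g' \<longleftrightarrow> (\<forall>x\<in>S. has_dir_deriv g (g' x) (1, 0) x)"

lemma radial_deriv_scaleR: "radial_deriv S g g' \<Longrightarrow> radial_deriv S (\<lambda>x. c *\<^sub>R g x) (\<lambda>x. c *\<^sub>R g' x)"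
  unfolding radial_deriv_def
proof (intro ballI allI)
  fix x i assume "\<forall>x\<in>S. \<forall>i. has_dir_deriv g (snd x $ i *\<^sub>R g' x) (0, axis i 1) x" and "x \<in> S"
  then have "has_dir_deriv (\<lambda>x. c *\<^sub>R g x) (c *\<^sub>R (snd x $ i *\<^sub>R g' x)) (0, axis i 1) x"
    by (intro has_dir_deriv_scaleR_const) blast
  then show "has_dir_deriv (\<lambda>x. c *\<^sub>R g x) (snd x $ i *\<^sub>R (c *\<^sub>R g' x)) (0, axis i 1) x"
    by (simp add: mult.commute)
qed

lemma axial_deriv_scaleR: "axial_deriv S g g' \<Longrightarrow> axial_deriv S (\<lambda>x. c *\<^sub>R g x) (\<lambda>x. c *\<^sub>R g' x)"
  unfolding axial_deriv_def by (blast intro: has_dir_deriv_scaleR_const)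

text \<open>The i-th second derivative of \<open>g\<close> is g1 + x_i^2 g2; summing over i gives m
  g1 + \<beta>^2 g2. For the product with \<open>vec_part\<close>, the mixed terms 2 x_i e_i h1 add
  up to 2 \<open>vec_part\<close> times \<open>h1\<close>, hence m + 2.\<close>

lemma laplacian_slice:
  fixes u :: "'n::{finite,linorder} paravec \<Rightarrow> 'n clifford"
  assumes S: "open S" "x \<in> S"
    and u: "\<And>y. y \<in> S \<Longrightarrow> u y = g y + vec_part y \<odot> h y"
    and g: "radial_deriv S g g1" "radial_deriv S g1 g2" "axial_deriv S g ga" "axial_deriv S ga gaa"
    and h: "radial_deriv S h h1" "radial_deriv S h1 h2" "axial_deriv S h ha" "axial_deriv S ha haa"
  shows "laplacian u x = gaa x + real CARD('n) *\<^sub>R g1 x + (norm (snd x))\<^sup>2 *\<^sub>R g2 x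
    + vec_part x \<odot> (haa x + (real CARD('n) + 2) *\<^sub>R h1 x + (norm (snd x))\<^sup>2 *\<^sub>R h2 x)"
proof -
  note bil = has_dir_deriv_bilinear[OF bounded_bilinear_cl_mult]
  have "dir_deriv (1, 0) u y = ga y + vec_part y \<odot> ha y" if "y \<in> S" for y
  proof -
    have "has_dir_deriv (\<lambda>y. g y + vec_part y \<odot> h y) (ga y + (vec_part y \<odot> ha y + 0 \<odot> h y)) (1, 0) y"
      using g h that unfolding axial_deriv_def
      by (intro has_dir_deriv_add bil has_dir_deriv_vec_part) auto
    from dir_deriv_eq[OF this] show ?thesis
      by (simp add: cl_mult.zero_left dir_deriv_cong[OF S(1) that u])
  qed
  moreover have "has_dir_deriv (\<lambda>y. ga y + vec_part y \<odot> ha y) (gaa x + (vec_part x \<odot> haa x + 0 \<odot> ha x)) (1, 0) x"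
    using g h S unfolding axial_deriv_def
    by (intro has_dir_deriv_add bil has_dir_deriv_vec_part) auto
  ultimately have axial: "dir_deriv (1, 0) (dir_deriv (1, 0) u) x = gaa x + vec_part x \<odot> haa x"
    using dir_deriv_eq dir_deriv_cong[OF S, of "dir_deriv (1, 0) u" "\<lambda>y. ga y + vec_part y \<odot> ha y"]
    by (simp add: cl_mult.zero_left)
  have radial: "dir_deriv (0, axis i 1) (dir_deriv (0, axis i 1) u) x
    = g1 x + (snd x $ i)\<^sup>2 *\<^sub>R g2 x + vec_part x \<odot> (h1 x + (snd x $ i)\<^sup>2 *\<^sub>R h2 x)
      + ((snd x $ i *\<^sub>R cl_gen i) \<odot> h1 x + (snd x $ i *\<^sub>R cl_gen i) \<odot> h1 x)" for i
  proof -
    \<comment> \<open>\<open>k\<close> is the i-th partial derivative of \<open>u\<close> throughout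
      \<open>S\<close>.\<close>
    define k where "k y = snd y $ i *\<^sub>R g1 y + (vec_part y \<odot> (snd y $ i *\<^sub>R h1 y) + cl_gen i \<odot> h y)" for y
    have "dir_deriv (0, axis i 1) u y = k y" if "y \<in> S" for y
    proof -
      have "has_dir_deriv (\<lambda>y. g y + vec_part y \<odot> h y) (k y) (0, axis i 1) y"
        using g h that unfolding radial_deriv_def k_def
        by (intro has_dir_deriv_add bil has_dir_deriv_vec_part) auto
      from dir_deriv_eq[OF this] show ?thesis
        by (simp add: dir_deriv_cong[OF S(1) that u])
    qed
    then have "dir_deriv (0, axis i 1) (dir_deriv (0, axis i 1) u) x = dir_deriv (0, axis i 1) k x"
      by (rule dir_deriv_cong[OF S])
    also have "dir_deriv (0, axis i 1) k x =
        (snd x $ i *\<^sub>R (snd x $ i *\<^sub>R g2 x) + 1 *\<^sub>R g1 x)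
        + ((vec_part x \<odot> (snd x $ i *\<^sub>R (snd x $ i *\<^sub>R h2 x) + 1 *\<^sub>R h1 x) + cl_gen i \<odot> (snd x $ i *\<^sub>R h1 x))
        + (cl_gen i \<odot> (snd x $ i *\<^sub>R h1 x) + 0 \<odot> h x))"
    proof (rule dir_deriv_eq)
      show "has_dir_deriv k
        ((snd x $ i *\<^sub>R (snd x $ i *\<^sub>R g2 x) + 1 *\<^sub>R g1 x)
        + ((vec_part x \<odot> (snd x $ i *\<^sub>R (snd x $ i *\<^sub>R h2 x) + 1 *\<^sub>R h1 x) + cl_gen i \<odot> (snd x $ i *\<^sub>R h1 x))
        + (cl_gen i \<odot> (snd x $ i *\<^sub>R h1 x) + 0 \<odot> h x))) (0, axis i 1) x"
        unfolding k_def[abs_def] using g h S has_dir_deriv_coord[of i i x] unfolding radial_deriv_def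
        by (intro has_dir_deriv_add bil has_dir_deriv_scaleR has_dir_deriv_vec_part has_dir_deriv_const) auto
    qed
    finally show ?thesis
      by (simp add: power2_eq_square cl_mult.zero_left cl_mult.scaleR_left cl_mult.scaleR_right
          cl_mult.add_right add_ac)
  qed
  have vec: "(\<Sum>i\<in>UNIV. (snd x $ i *\<^sub>R cl_gen i) \<odot> h1 x) = vec_part x \<odot> h1 x"
    by (simp only: vec_part_def cl_mult.sum_left)
  have nrm: "(norm (snd x))\<^sup>2 = (\<Sum>i\<in>UNIV. (snd x $ i)\<^sup>2)"
    by (simp add: norm_vec_def L2_set_def sum_nonneg)
  have "(\<Sum>i\<in>UNIV. dir_deriv (0, axis i 1) (dir_deriv (0, axis i 1) u) x)
    = real CARD('n) *\<^sub>R g1 x + (norm (snd x))\<^sup>2 *\<^sub>R g2 x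
    + vec_part x \<odot> (real CARD('n) *\<^sub>R h1 x + (norm (snd x))\<^sup>2 *\<^sub>R h2 x)
      + (vec_part x \<odot> h1 x + vec_part x \<odot> h1 x)"
    unfolding radial nrm
    by (simp only: sum.distrib scaleR_sum_left cl_mult.add_right cl_mult.sum_right
        cl_mult.scaleR_right sum_constant_scaleR vec)
  then show ?thesis
    unfolding laplacian_paravec axial
    by (simp only: cl_mult.add_right cl_mult.scaleR_right scaleR_add_left scaleR_2 add_ac)
qed

section \<open>Functions of the complex coordinate\<close>

definition slice_coord :: "'n::{finite,linorder} paravec \<Rightarrow> complex" where
  "slice_coord x = Complex (fst x) (norm (snd x))"

lemma Im_slice_coord: "Im (slice_coord x) = norm (snd x)"
  by (simp add: slice_coord_def)

text \<open>\<open>circular_set\<close> allows both signs of \<beta>, while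
  \<open>slice_coord\<close> uses \<beta> = norm; symmetry of \<open>D\<close> absorbs the
  sign.\<close>

lemma circular_set_iff:
  assumes "symmetric_set D"
  shows "(x :: 'n::{finite,linorder} paravec) \<in> circular_set D \<longleftrightarrow> slice_coord x \<in> D"
proof
  have unit: "J \<in> imag_units \<longleftrightarrow> fst J = 0 \<and> norm (snd J) = 1" for J :: "'n paravec"
    by (simp add: imag_units_def norm_vec_def L2_set_def)
  assume "x \<in> circular_set D"
  then obtain \<alpha> \<beta> and J :: "'n paravec"
    where x: "x = (\<alpha>, 0) + \<beta> *\<^sub>R J" "Complex \<alpha> \<beta> \<in> D" "J \<in> imag_units"
    by (auto simp: circular_set_def)
  have "slice_coord x = Complex \<alpha> \<bar>\<beta>\<bar>"
    using x by (simp add: slice_coord_def unit)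
  moreover have "cnj (Complex \<alpha> \<beta>) \<in> D" using x(2) assms unfolding symmetric_set_def by blast
  ultimately show "slice_coord x \<in> D" using x(2) by (cases "\<beta> \<ge> 0") (auto simp: complex_cnj)
next
  assume D: "slice_coord x \<in> D"
  have "\<exists>v :: (real, 'n) vec. norm v = 1 \<and> snd x = norm (snd x) *\<^sub>R v"
  proof (cases "snd x = 0")
    case True
    \<comment> \<open>On the real axis every imaginary unit represents the point.\<close>
    then show ?thesis using norm_axis_1 by (intro exI[of _ "axis undefined 1"]) simp
  next
    case False
    then show ?thesis by (intro exI[of _ "sgn (snd x)"]) (simp add: norm_sgn sgn_div_norm)
  qed
  then obtain v :: "(real, 'n) vec" where v: "norm v = 1" "snd x = norm (snd x) *\<^sub>R v" by blast
  have "x = (fst x, 0) + norm (snd x) *\<^sub>R (0, v)" using v by (simp add: prod_eq_iff)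
  moreover have "(0, v) \<in> imag_units"
    using v by (simp add: imag_units_def norm_vec_def L2_set_def)
  ultimately show "x \<in> circular_set D"
    using D unfolding circular_set_def slice_coord_def by blast
qed

lemma open_circular_set:
  assumes "open D" "symmetric_set D"
  shows "open (circular_set D :: 'n::{finite,linorder} paravec set)"
proof -
  have "continuous_on UNIV (slice_coord :: 'n paravec \<Rightarrow> complex)"
    unfolding slice_coord_def Complex_eq by (intro continuous_intros)
  then have "open (slice_coord -` D :: 'n paravec set)"
    using assms(1) by (simp add: continuous_on_open_vimage)
  moreover have "circular_set D = (slice_coord -` D :: 'n paravec set)"
    using circular_set_iff[OF assms(2)] by blast
  ultimately show ?thesis by simp
qed

lemma axial_deriv_slice_coord:
  fixes S :: "'n::{finite,linorder} paravec set"
  assumes "\<And>x. x \<in> S \<Longrightarrow> has_dir_deriv G (G' (slice_coord x)) 1 (slice_coord x)"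
  shows "axial_deriv S (\<lambda>x. G (slice_coord x)) (\<lambda>x. G' (slice_coord x))"
proof -
  have "slice_coord (x + t *\<^sub>R (1, 0)) = slice_coord x + t *\<^sub>R 1" for x :: "'n paravec" and t
    by (simp add: slice_coord_def complex_eq_iff)
  then show ?thesis using assms by (simp add: axial_deriv_def has_dir_deriv_def)
qed

text \<open>The corner of the absolute value is harmless when the derivative is 0, since only the
  size of the difference quotient matters.\<close>

lemma has_vector_derivative_compose_abs:
  assumes "(g has_vector_derivative 0) (at (0::real))"
  shows "((\<lambda>t. g \<bar>t\<bar>) has_vector_derivative 0) (at 0)"
proof -
  have "(\<lambda>h. norm (g h - g 0) / norm h) \<midarrow>0\<rightarrow> 0"
    using assms by (simp add: has_vector_derivative_def has_derivative_at)
  moreover have "filterlim abs (at 0) (at (0::real))"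
    by (simp add: filterlim_at tendsto_rabs_zero eventually_at_filter)
  ultimately have "(\<lambda>h. norm (g \<bar>h\<bar> - g 0) / norm \<bar>h\<bar>) \<midarrow>0\<rightarrow> 0"
    by (rule filterlim_compose)
  then show ?thesis by (simp add: has_vector_derivative_def has_derivative_at)
qed

text \<open>By the chain rule the i-th derivative of \<beta> is x_i / \<beta>, and the \<beta>
  cancels against the factor in the hypothesis. On the real axis \<beta> moves as |t| and that
  factor is 0.\<close>

lemma radial_deriv_slice_coord:
  fixes S :: "'n::{finite,linorder} paravec set"
  assumes "\<And>x. x \<in> S \<Longrightarrow> has_dir_deriv G (norm (snd x) *\<^sub>R G' (slice_coord x)) \<i> (slice_coord x)"
  shows "radial_deriv S (\<lambda>x. G (slice_coord x)) (\<lambda>x. G' (slice_coord x))"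
  unfolding radial_deriv_def
proof (intro ballI allI)
  fix x i assume x: "x \<in> S"
  have G: "((\<lambda>t. G (slice_coord x + t *\<^sub>R \<i>)) has_vector_derivative norm (snd x) *\<^sub>R G' (slice_coord x)) (at 0)"
    using assms[OF x] by (simp add: has_dir_deriv_def)
  define s where "s t = norm (snd x + t *\<^sub>R axis i 1) - norm (snd x)" for t
  have s: "slice_coord (x + t *\<^sub>R (0, axis i 1)) = slice_coord x + s t *\<^sub>R \<i>" for t
    by (simp add: slice_coord_def complex_eq_iff s_def)
  show "has_dir_deriv (\<lambda>x. G (slice_coord x)) (snd x $ i *\<^sub>R G' (slice_coord x)) (0, axis i 1) x"
  proof (cases "snd x = 0")
    case True
    then have "s t = \<bar>t\<bar>" for t by (simp add: s_def)
    with True G has_vector_derivative_compose_abs[of "\<lambda>t. G (slice_coord x + t *\<^sub>R \<i>)"]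
    show ?thesis unfolding has_dir_deriv_def s by simp
  next
    case False
    have "((\<lambda>t. norm (snd x + t *\<^sub>R axis i 1)) has_vector_derivative (axis i 1 \<bullet> sgn (snd x))) (at 0)"
      using has_derivative_imp_has_dir_deriv[OF has_derivative_norm[OF False]]
      by (simp add: has_dir_deriv_def)
    moreover have "axis i 1 \<bullet> sgn (snd x) = snd x $ i / norm (snd x)"
      by (simp add: inner_axis' sgn_div_norm divide_inverse mult.commute)
    ultimately have "((\<lambda>t. norm (snd x + t *\<^sub>R axis i 1)) has_vector_derivative (snd x $ i / norm (snd x))) (at 0)"
      by simp
    from has_vector_derivative_diff[OF this has_vector_derivative_const]
    have "(s has_vector_derivative (snd x $ i / norm (snd x))) (at 0)"
      by (simp add: s_def[abs_def])
    moreover have "s 0 = 0" by (simp add: s_def)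
    ultimately have "(((\<lambda>t. G (slice_coord x + t *\<^sub>R \<i>)) \<circ> s) has_vector_derivative
        (snd x $ i / norm (snd x)) *\<^sub>R (norm (snd x) *\<^sub>R G' (slice_coord x))) (at 0)"
      using G by (intro vector_diff_chain_at) simp_all
    then show ?thesis using False unfolding has_dir_deriv_def s by (simp add: o_def)
  qed
qed

section \<open>Stem functions of slice regular functions\<close>

definition stem_comp :: "'n::{finite,linorder} stem \<Rightarrow> 'n set \<Rightarrow> complex \<Rightarrow> complex" where
  "stem_comp F A z = Complex (fst (F z) $ A) (snd (F z) $ A)"

lemma fst_stem: "fst (F z) = (\<chi> A. Re (stem_comp F A z))"
  and snd_stem: "snd (F z) = (\<chi> A. Im (stem_comp F A z))"
  by (simp_all add: stem_comp_def vec_eq_iff)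

text \<open>The Cauchy-Riemann equations say that the real derivative \<open>L\<close> of a
  component is multiplication by the complex number \<open>L 1\<close>.\<close>

lemma intrinsic_on_stem_comp:
  assumes F: "slice_regular D F f" and D: "symmetric_set D"
  shows "intrinsic_on D (stem_comp F A)"
  unfolding intrinsic_on_def
proof (intro conjI ballI)
  fix z assume z: "z \<in> D"
  then show "cnj z \<in> D" using D by (auto simp: symmetric_set_def)
  show "stem_comp F A (cnj z) = cnj (stem_comp F A z)"
    using F z by (simp add: slice_regular_def stem_function_def stem_comp_def complex_eq_iff)
next
  have "\<exists>d. (stem_comp F A has_field_derivative d) (at z)" if z: "z \<in> D" for z
  proof -
    obtain F' where F': "(F has_derivative F') (at z)"
      using F z unfolding slice_regular_def C1_on_def by blast
    then interpret F': bounded_linear F' by (rule has_derivative_bounded_linear)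
    define L where "L w = Complex (fst (F' w) $ A) (snd (F' w) $ A)" for w
    have "(stem_comp F A has_derivative L) (at z)"
      unfolding stem_comp_def[abs_def] L_def[abs_def] Complex_eq
      by (intro derivative_intros bounded_linear.has_derivative[OF bounded_linear_vec_nth]
          bounded_linear.has_derivative[OF bounded_linear_of_real]
          bounded_linear.has_derivative[OF bounded_linear_fst F']
          bounded_linear.has_derivative[OF bounded_linear_snd F'])
    moreover have "L w = L 1 * w" for w
    proof -
      have d: "has_dir_deriv F (F' v) v z" for v
        by (rule has_derivative_imp_has_dir_deriv[OF F'])
      have "dir_deriv v (\<lambda>w. fst (F w)) z = fst (F' v)" "dir_deriv v (\<lambda>w. snd (F w)) z = snd (F' v)" for v
        using d by (auto intro!: dir_deriv_eq has_dir_deriv_linear[OF bounded_linear_fst]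
            has_dir_deriv_linear[OF bounded_linear_snd])
      then have "fst (F' 1) = snd (F' \<i>)" "fst (F' \<i>) = - snd (F' 1)"
        using F z by (auto simp: slice_regular_def)
      moreover have "F' w = Re w *\<^sub>R F' 1 + Im w *\<^sub>R F' \<i>"
      proof -
        have "w = Re w *\<^sub>R 1 + Im w *\<^sub>R \<i>" by (simp add: complex_eq_iff)
        then have "F' w = F' (Re w *\<^sub>R 1 + Im w *\<^sub>R \<i>)" by (rule arg_cong)
        then show ?thesis by (simp only: F'.add F'.scaleR)
      qed
      ultimately show ?thesis by (simp add: L_def complex_eq_iff algebra_simps)
    qed
    ultimately show ?thesis
      unfolding has_field_derivative_def by (metis ext)
  qed
  then show "stem_comp F A holomorphic_on D"
    unfolding holomorphic_on_def field_differentiable_def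
    by (blast intro: has_field_derivative_at_within)
qed

lemma slice_fun_slice_coord: "slice_fun G x = fst (G (slice_coord x)) + para (0, sgn (snd x)) \<odot> snd (G (slice_coord x))"
  by (simp add: slice_fun_def slice_coord_def Let_def)

text \<open>For the stem (g, 0), applying d/d\<alpha> - \<iota> d/d\<beta> gives (a, -b).\<close>

lemma slice_deriv_stem_of:
  assumes "has_dir_deriv g a 1 (slice_coord x)" "has_dir_deriv g b \<i> (slice_coord x)"
  shows "slice_deriv (stem_of g) x = (1 / 2) *\<^sub>R (a - para (0, sgn (snd x)) \<odot> b)"
proof -
  have "bounded_linear (\<lambda>y. (y, 0))"
    by (intro bounded_linear_Pair bounded_linear_ident bounded_linear_zero)
  from has_dir_deriv_linear[OF this] assms
  have "d_alpha (stem_of g) (slice_coord x) = (a, 0)" "d_beta (stem_of g) (slice_coord x) = (b, 0)"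
    by (auto intro!: dir_deriv_eq simp: stem_of_def[abs_def])
  then show ?thesis
    unfolding slice_deriv_def slice_fun_slice_coord
    by (simp add: iota_mult_def cl_mult.scaleR_right cl_mult.minus_right algebra_simps)
qed

text \<open>The whole sum \<open>p\<close> has known derivatives, so uniqueness identifies the sums
  of the individual derivatives with \<open>a\<close> and \<open>b\<close>.\<close>

lemma sum_slice_deriv_stem_of:
  fixes g :: "nat \<Rightarrow> complex \<Rightarrow> 'n::{finite,linorder} clifford"
  assumes "\<And>j. j \<in> I \<Longrightarrow> has_dir_deriv (g j) (ga j) 1 (slice_coord x)"
    and "\<And>j. j \<in> I \<Longrightarrow> has_dir_deriv (g j) (gb j) \<i> (slice_coord x)"
    and S: "open S" "slice_coord x \<in> S" and p: "\<And>z. z \<in> S \<Longrightarrow> p z = (\<Sum>j\<in>I. c j *\<^sub>R g j z)"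
    and pa: "has_dir_deriv p a 1 (slice_coord x)" and pb: "has_dir_deriv p b \<i> (slice_coord x)"
  shows "(\<Sum>j\<in>I. c j *\<^sub>R slice_deriv (stem_of (g j)) x) = (1 / 2) *\<^sub>R (a - para (0, sgn (snd x)) \<odot> b)"
proof -
  let ?s = "\<lambda>z. \<Sum>j\<in>I. c j *\<^sub>R g j z"
  have "has_dir_deriv ?s (\<Sum>j\<in>I. c j *\<^sub>R ga j) 1 (slice_coord x)"
    "has_dir_deriv ?s (\<Sum>j\<in>I. c j *\<^sub>R gb j) \<i> (slice_coord x)"
    using assms by (auto intro!: has_dir_deriv_sum has_dir_deriv_scaleR_const)
  moreover have "has_dir_deriv ?s a 1 (slice_coord x)" "has_dir_deriv ?s b \<i> (slice_coord x)"
    using has_dir_deriv_cong[OF pa S p] has_dir_deriv_cong[OF pb S p] by auto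
  ultimately have "a = (\<Sum>j\<in>I. c j *\<^sub>R ga j)" "b = (\<Sum>j\<in>I. c j *\<^sub>R gb j)"
    using has_dir_deriv_unique by blast+
  then have "(1 / 2) *\<^sub>R (a - para (0, sgn (snd x)) \<odot> b)
     = (\<Sum>j\<in>I. c j *\<^sub>R ((1 / 2) *\<^sub>R (ga j - para (0, sgn (snd x)) \<odot> gb j)))"
    by (simp add: cl_mult.sum_right cl_mult.scaleR_right scaleR_sum_right scaleR_diff_right
        sum_subtractf mult.commute)
  moreover have "slice_deriv (stem_of (g j)) x = (1 / 2) *\<^sub>R (ga j - para (0, sgn (snd x)) \<odot> gb j)" if "j \<in> I" for j
    using assms that by (intro slice_deriv_stem_of) auto
  ultimately show ?thesis by simp
qed

text \<open>
  \<open>slice_sph F j k\<close> is \<open>\<partial>\<^sub>\<alpha>\<^sup>j (\<beta>\<^sup>-\<^sup>1 \<partial>\<^sub>\<beta>)\<^sup>k f'\<^sub>s\<close>, also defined on the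
  real axis.
\<close>

definition slice_sph :: "'n::{finite,linorder} stem \<Rightarrow> nat \<Rightarrow> nat \<Rightarrow> complex \<Rightarrow> 'n clifford" where
  "slice_sph F j k z = (\<chi> A. sph ((deriv ^^ j) (stem_comp F A)) k z)"

definition slice_re :: "'n::{finite,linorder} stem \<Rightarrow> nat \<Rightarrow> complex \<Rightarrow> 'n clifford" where
  "slice_re F j z = (\<chi> A. Re ((deriv ^^ j) (stem_comp F A) z))"

text \<open>The slice derivative of \<open>(\<beta>\<^sup>-\<^sup>1 \<partial>\<^sub>\<beta>)\<^sup>k f'\<^sub>s\<close>, also defined on the real axis.\<close>

definition slice_tower :: "'n::{finite,linorder} stem \<Rightarrow> nat \<Rightarrow> 'n paravec \<Rightarrow> 'n clifford" where
  "slice_tower F k x = (1 / 2) *\<^sub>R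
    (slice_sph F 1 k (slice_coord x) - vec_part x \<odot> slice_sph F 0 (Suc k) (slice_coord x))"

section \<open>Iterated Laplacians of a fixed slice regular function\<close>

context
  fixes D :: "complex set" and F :: "'n::{finite,linorder} stem" and f :: "'n paravec \<Rightarrow> 'n clifford"
  assumes D: "open D" "symmetric_set D" and F: "slice_regular D F f"
begin

lemma intrinsic_comp: "intrinsic_on D ((deriv ^^ j) (stem_comp F A))"
  using intrinsic_on_higher_deriv[OF D(1) intrinsic_on_stem_comp[OF F D(2)]] .

lemma holomorphic_comp: "(deriv ^^ j) (stem_comp F A) holomorphic_on D"
  using intrinsic_comp by (simp add: intrinsic_on_def)

lemma has_dir_deriv_slice_sph:
  assumes "z \<in> D"
  shows "has_dir_deriv (slice_sph F j k) (Im z *\<^sub>R slice_sph F j (Suc k) z) \<i> z"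
    and "has_dir_deriv (slice_sph F j k) (slice_sph F (Suc j) k z) 1 z"
proof -
  have "has_dir_deriv (slice_sph F j k) (\<chi> A. Im z *\<^sub>R sph ((deriv ^^ j) (stem_comp F A)) (Suc k) z) \<i> z"
    unfolding slice_sph_def[abs_def] using D assms intrinsic_comp
    by (intro has_dir_deriv_vec has_dir_deriv_sph_beta)
  also have "(\<chi> A. Im z *\<^sub>R sph ((deriv ^^ j) (stem_comp F A)) (Suc k) z) = Im z *\<^sub>R slice_sph F j (Suc k) z"
    by (simp add: slice_sph_def vec_eq_iff)
  finally show "has_dir_deriv (slice_sph F j k) (Im z *\<^sub>R slice_sph F j (Suc k) z) \<i> z" .
  have "has_dir_deriv (slice_sph F j k) (\<chi> A. sph (deriv ((deriv ^^ j) (stem_comp F A))) k z) 1 z"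
    unfolding slice_sph_def[abs_def] using D assms holomorphic_comp
    by (intro has_dir_deriv_vec has_dir_deriv_sph_alpha)
  then show "has_dir_deriv (slice_sph F j k) (slice_sph F (Suc j) k z) 1 z"
    by (simp add: slice_sph_def)
qed

text \<open>The \<beta>-derivative of Re h is - Im h', and \<open>Im_sph_0\<close> extracts the
  factor \<open>Im z\<close> from it.\<close>

lemma has_dir_deriv_slice_re:
  assumes "z \<in> D"
  shows "has_dir_deriv (slice_re F j) (Im z *\<^sub>R - slice_sph F (Suc j) 0 z) \<i> z"
    and "has_dir_deriv (slice_re F j) (slice_re F (Suc j) z) 1 z"
proof -
  have *: "has_dir_deriv (slice_re F j) (\<chi> A. Re (deriv ((deriv ^^ j) (stem_comp F A)) z * v)) v z" for v
    unfolding slice_re_def[abs_def] using D assms holomorphic_comp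
    by (intro has_dir_deriv_vec has_dir_deriv_linear[OF bounded_linear_Re] has_dir_deriv_holomorphic)
  have "(\<chi> A. Re (deriv ((deriv ^^ j) (stem_comp F A)) z * \<i>)) = Im z *\<^sub>R - slice_sph F (Suc j) 0 z"
    using Im_sph_0[OF intrinsic_comp[of "Suc j"] assms] by (simp add: slice_sph_def vec_eq_iff)
  then show "has_dir_deriv (slice_re F j) (Im z *\<^sub>R - slice_sph F (Suc j) 0 z) \<i> z"
    using *[of \<i>] by simp
  show "has_dir_deriv (slice_re F j) (slice_re F (Suc j) z) 1 z"
    using *[of 1] by (simp add: slice_re_def)
qed

lemma slice_sph_ode:
  assumes "z \<in> D"
  shows "slice_sph F (Suc (Suc j)) k z + (Im z)\<^sup>2 *\<^sub>R slice_sph F j (Suc (Suc k)) z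
    = - (2 * real k + 3) *\<^sub>R slice_sph F j (Suc k) z"
proof -
  have "sph (deriv (deriv h)) k z + (Im z)\<^sup>2 * sph h (Suc (Suc k)) z = - (2 * real k + 3) * sph h (Suc k) z"
    if "intrinsic_on D h" for h
    using sph_ode[OF D(1) that assms, of k] by (simp add: algebra_simps)
  then show ?thesis using intrinsic_comp by (simp add: slice_sph_def vec_eq_iff)
qed

lemma slice_re_ode:
  assumes "z \<in> D"
  shows "slice_re F (Suc j) z - (Im z)\<^sup>2 *\<^sub>R slice_sph F j 1 z = slice_sph F j 0 z"
proof -
  have "Re (deriv h z) - (Im z)\<^sup>2 * sph h 1 z = sph h 0 z" for h
    using sph_1[of z h] by (cases "Im z = 0") (simp_all add: sph_def)
  then show ?thesis by (simp add: slice_re_def slice_sph_def vec_eq_iff)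
qed

lemma slice_derivs_coord:
  defines "S \<equiv> (circular_set D :: 'n paravec set)"
  shows "radial_deriv S (\<lambda>x. slice_sph F j k (slice_coord x)) (\<lambda>x. slice_sph F j (Suc k) (slice_coord x))"
    and "axial_deriv S (\<lambda>x. slice_sph F j k (slice_coord x)) (\<lambda>x. slice_sph F (Suc j) k (slice_coord x))"
    and "radial_deriv S (\<lambda>x. slice_re F j (slice_coord x)) (\<lambda>x. - slice_sph F (Suc j) 0 (slice_coord x))"
    and "axial_deriv S (\<lambda>x. slice_re F j (slice_coord x)) (\<lambda>x. slice_re F (Suc j) (slice_coord x))"
proof -
  have z: "slice_coord x \<in> D" if "x \<in> S" for x
    using that circular_set_iff[OF D(2)] unfolding S_def by blast
  show "radial_deriv S (\<lambda>x. slice_sph F j k (slice_coord x)) (\<lambda>x. slice_sph F j (Suc k) (slice_coord x))"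
    by (rule radial_deriv_slice_coord) (use has_dir_deriv_slice_sph(1)[OF z] in \<open>simp add: Im_slice_coord\<close>)
  show "axial_deriv S (\<lambda>x. slice_sph F j k (slice_coord x)) (\<lambda>x. slice_sph F (Suc j) k (slice_coord x))"
    by (rule axial_deriv_slice_coord) (rule has_dir_deriv_slice_sph(2)[OF z])
  show "radial_deriv S (\<lambda>x. slice_re F j (slice_coord x)) (\<lambda>x. - slice_sph F (Suc j) 0 (slice_coord x))"
    by (rule radial_deriv_slice_coord[where G' = "\<lambda>z. - slice_sph F (Suc j) 0 z"])
      (use has_dir_deriv_slice_re(1)[OF z] in \<open>simp add: Im_slice_coord\<close>)
  show "axial_deriv S (\<lambda>x. slice_re F j (slice_coord x)) (\<lambda>x. slice_re F (Suc j) (slice_coord x))"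
    by (rule axial_deriv_slice_coord) (rule has_dir_deriv_slice_re(2)[OF z])
qed

lemma slice_regular_eq:
  assumes "x \<in> circular_set D"
  shows "f x = slice_re F 0 (slice_coord x) + vec_part x \<odot> slice_sph F 0 0 (slice_coord x)"
proof -
  have z: "slice_coord x \<in> D" using assms circular_set_iff[OF D(2)] by blast
  have "snd (F (slice_coord x)) = norm (snd x) *\<^sub>R slice_sph F 0 0 (slice_coord x)"
    using Im_sph_0[OF intrinsic_comp[of 0] z]
    by (simp add: snd_stem slice_sph_def vec_eq_iff Im_slice_coord)
  moreover have "f x = fst (F (slice_coord x)) + para (0, sgn (snd x)) \<odot> snd (F (slice_coord x))"
    using F assms by (simp add: slice_regular_def slice_fun_slice_coord)
  moreover have "fst (F (slice_coord x)) = slice_re F 0 (slice_coord x)"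
    by (simp add: fst_stem slice_re_def)
  ultimately show ?thesis
    by (simp add: cl_mult.scaleR_right flip: para_sgn cl_mult.scaleR_left)
qed

text \<open>In \<open>laplacian_slice\<close> the two relations above cancel all \<beta>^2 terms,
  leaving the coefficients 1 - m and (m + 2) - 3 = m - 1.\<close>

lemma laplacian_slice_regular:
  assumes "x \<in> circular_set D"
  shows "laplacian f x = (- 2 * (real CARD('n) - 1)) *\<^sub>R slice_tower F 0 x"
proof -
  have z: "slice_coord x \<in> D" using assms circular_set_iff[OF D(2)] by blast
  note d = slice_derivs_coord
  note r = radial_deriv_scaleR[OF d(1), of "- 1", unfolded scaleR_minus1_left]
  let ?z = "slice_coord x"
  have "laplacian f x = slice_re F (Suc (Suc 0)) ?z + real CARD('n) *\<^sub>R - slice_sph F (Suc 0) 0 ?z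
     + (norm (snd x))\<^sup>2 *\<^sub>R - slice_sph F (Suc 0) (Suc 0) ?z
     + vec_part x \<odot> (slice_sph F (Suc (Suc 0)) 0 ?z + (real CARD('n) + 2) *\<^sub>R slice_sph F 0 (Suc 0) ?z
         + (norm (snd x))\<^sup>2 *\<^sub>R slice_sph F 0 (Suc (Suc 0)) ?z)"
    by (rule laplacian_slice[OF open_circular_set[OF D] assms slice_regular_eq
          d(3) r d(4) d(4) d(1) d(1) d(2) d(2)])
  also have "slice_re F (Suc (Suc 0)) ?z = slice_sph F (Suc 0) 0 ?z + (norm (snd x))\<^sup>2 *\<^sub>R slice_sph F (Suc 0) (Suc 0) ?z"
    using slice_re_ode[OF z, of "Suc 0"] by (simp add: Im_slice_coord diff_eq_eq)
  also have "slice_sph F (Suc (Suc 0)) 0 ?z = - 3 *\<^sub>R slice_sph F 0 (Suc 0) ?z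
      - (norm (snd x))\<^sup>2 *\<^sub>R slice_sph F 0 (Suc (Suc 0)) ?z"
    using slice_sph_ode[OF z, of 0 0] by (simp add: Im_slice_coord eq_diff_eq)
  also have "slice_sph F (Suc 0) 0 ?z + (norm (snd x))\<^sup>2 *\<^sub>R slice_sph F (Suc 0) (Suc 0) ?z
      + real CARD('n) *\<^sub>R - slice_sph F (Suc 0) 0 ?z + (norm (snd x))\<^sup>2 *\<^sub>R - slice_sph F (Suc 0) (Suc 0) ?z
      = (1 - real CARD('n)) *\<^sub>R slice_sph F (Suc 0) 0 ?z"
    by (simp add: scaleR_diff_left)
  also have "- 3 *\<^sub>R slice_sph F 0 (Suc 0) ?z - (norm (snd x))\<^sup>2 *\<^sub>R slice_sph F 0 (Suc (Suc 0)) ?z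
      + (real CARD('n) + 2) *\<^sub>R slice_sph F 0 (Suc 0) ?z + (norm (snd x))\<^sup>2 *\<^sub>R slice_sph F 0 (Suc (Suc 0)) ?z
      = (real CARD('n) - 1) *\<^sub>R slice_sph F 0 (Suc 0) ?z"
    by (simp flip: scaleR_diff_left)
  finally have L: "laplacian f x = (1 - real CARD('n)) *\<^sub>R slice_sph F (Suc 0) 0 ?z
      + vec_part x \<odot> ((real CARD('n) - 1) *\<^sub>R slice_sph F 0 (Suc 0) ?z)" .
  show ?thesis
    unfolding L cl_mult.scaleR_right by (simp add: slice_tower_def algebra_simps)
qed

text \<open>After the \<beta>^2 terms cancel, the scalar part carries m - (2k + 3) and the vector
  part (m + 2) - (2k + 5). These agree, so the tower is reproduced one level up.\<close>

lemma laplacian_slice_tower: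
  assumes "x \<in> circular_set D"
  shows "laplacian (\<lambda>x. c *\<^sub>R slice_tower F k x) x = (c * (real CARD('n) - (2 * real k + 3))) *\<^sub>R slice_tower F (Suc k) x"
proof -
  have z: "slice_coord x \<in> D" using assms circular_set_iff[OF D(2)] by blast
  note r = radial_deriv_scaleR[OF slice_derivs_coord(1)] and a = axial_deriv_scaleR[OF slice_derivs_coord(2)]
  have collect: "a *\<^sub>R (r *\<^sub>R P - s *\<^sub>R Q) + n *\<^sub>R (a *\<^sub>R P) + s *\<^sub>R (a *\<^sub>R Q) = (a * (r + n)) *\<^sub>R P"
    for a r s n and P Q :: "'n clifford"
    by (simp add: algebra_simps)
  let ?p = "\<lambda>j k x. (c / 2) *\<^sub>R slice_sph F j k (slice_coord x)"
  let ?q = "\<lambda>j k x. (- c / 2) *\<^sub>R slice_sph F j k (slice_coord x)"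
  have "laplacian (\<lambda>x. c *\<^sub>R slice_tower F k x) x = ?p (Suc (Suc (Suc 0))) k x + real CARD('n) *\<^sub>R ?p (Suc 0) (Suc k) x
     + (norm (snd x))\<^sup>2 *\<^sub>R ?p (Suc 0) (Suc (Suc k)) x
     + vec_part x \<odot> (?q (Suc (Suc 0)) (Suc k) x + (real CARD('n) + 2) *\<^sub>R ?q 0 (Suc (Suc k)) x
         + (norm (snd x))\<^sup>2 *\<^sub>R ?q 0 (Suc (Suc (Suc k))) x)"
  proof (rule laplacian_slice[OF open_circular_set[OF D] assms _ r r a a r r a a])
    show "c *\<^sub>R slice_tower F k y = ?p (Suc 0) k y + vec_part y \<odot> ?q 0 (Suc k) y" for y
      by (simp add: slice_tower_def cl_mult.scaleR_right cl_mult.minus_right scaleR_diff_right)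
  qed
  also have "slice_sph F (Suc (Suc (Suc 0))) k (slice_coord x) = - (2 * real k + 3) *\<^sub>R slice_sph F (Suc 0) (Suc k) (slice_coord x)
      - (norm (snd x))\<^sup>2 *\<^sub>R slice_sph F (Suc 0) (Suc (Suc k)) (slice_coord x)"
    using slice_sph_ode[OF z, of "Suc 0" k] by (simp add: Im_slice_coord eq_diff_eq)
  also have "slice_sph F (Suc (Suc 0)) (Suc k) (slice_coord x) = - (2 * real k + 5) *\<^sub>R slice_sph F 0 (Suc (Suc k)) (slice_coord x)
      - (norm (snd x))\<^sup>2 *\<^sub>R slice_sph F 0 (Suc (Suc (Suc k))) (slice_coord x)"
    using slice_sph_ode[OF z, of 0 "Suc k"] by (simp add: Im_slice_coord eq_diff_eq algebra_simps)
  finally have L: "laplacian (\<lambda>x. c *\<^sub>R slice_tower F k x) x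
    = (c / 2 * (- (2 * real k + 3) + real CARD('n))) *\<^sub>R slice_sph F (Suc 0) (Suc k) (slice_coord x)
      + vec_part x \<odot> ((- c / 2 * (- (2 * real k + 5) + (real CARD('n) + 2)))
          *\<^sub>R slice_sph F 0 (Suc (Suc k)) (slice_coord x))"
    unfolding collect .
  show ?thesis
    unfolding L
    by (simp add: slice_tower_def cl_mult.scaleR_right cl_mult.minus_right scaleR_diff_right field_simps)
qed

lemma iterated_laplacian:
  assumes "x \<in> circular_set D"
  shows "(laplacian ^^ (k + 1)) f x =
    (- 2 * (\<Prod>i=0..k. real CARD('n) - real (2 * i + 1))) *\<^sub>R slice_tower F k x"
  using assms
proof (induction k arbitrary: x)
  case 0
  then show ?case by (simp add: laplacian_slice_regular)
next
  case (Suc k)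
  let ?c = "\<lambda>k. - 2 * (\<Prod>i=0..k. real CARD('n) - real (2 * i + 1))"
  have "(laplacian ^^ (Suc k + 1)) f x = laplacian ((laplacian ^^ (k + 1)) f) x" by simp
  also have "\<dots> = laplacian (\<lambda>x. ?c k *\<^sub>R slice_tower F k x) x"
    using Suc.IH by (intro laplacian_cong[OF open_circular_set[OF D] Suc.prems])
  also have "\<dots> = ?c (Suc k) *\<^sub>R slice_tower F (Suc k) x"
    unfolding laplacian_slice_tower[OF Suc.prems] by (simp add: algebra_simps)
  finally show ?case .
qed

section \<open>Identification of the tower with the two displayed sums\<close>

lemma d_beta_iterate_snd:
  assumes "z \<in> D"
  shows "(d_beta ^^ l) (\<lambda>w. snd (F w)) z = (\<chi> A. deriv_Im (stem_comp F A) l z)"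
  using assms
proof (induction l arbitrary: z)
  case 0
  then show ?case by (simp add: snd_stem deriv_Im_0)
next
  case (Suc l)
  have "(d_beta ^^ Suc l) (\<lambda>w. snd (F w)) z = d_beta (\<lambda>z. \<chi> A. deriv_Im (stem_comp F A) l z) z"
    using dir_deriv_cong[OF D(1) Suc.prems Suc.IH] by simp
  also have "\<dots> = (\<chi> A. deriv_Im (stem_comp F A) (Suc l) z)"
    using D Suc.prems holomorphic_comp[of 0]
    by (intro dir_deriv_eq has_dir_deriv_vec has_dir_deriv_deriv_Im) auto
  finally show ?case .
qed

lemma open_off_real: "open (D \<inter> {z. Im z \<noteq> 0})"
  using D open_Im_nonzero by blast

lemma d_beta_iterate_spherical_deriv:
  assumes "z \<in> D \<inter> {z. Im z \<noteq> 0}"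
  shows "(d_beta ^^ l) (spherical_deriv F) z = (\<chi> A. deriv_sph (stem_comp F A) l z)"
  using assms
proof (induction l arbitrary: z)
  case 0
  then show ?case by (simp add: snd_stem spherical_deriv_def vec_eq_iff divide_inverse)
next
  case (Suc l)
  have "(d_beta ^^ Suc l) (spherical_deriv F) z = d_beta (\<lambda>z. \<chi> A. deriv_sph (stem_comp F A) l z) z"
    using dir_deriv_cong[OF open_off_real Suc.prems Suc.IH] by simp
  also have "\<dots> = (\<chi> A. deriv_sph (stem_comp F A) (Suc l) z)"
    using D Suc.prems holomorphic_comp[of 0]
    by (intro dir_deriv_eq has_dir_deriv_vec has_dir_deriv_deriv_sph) auto
  finally show ?case .
qed

text \<open>Both displayed sums are instances, according to the family \<open>u\<close> of iterated
  \<beta>-derivatives.\<close>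

lemma slice_tower_eq_sum:
  fixes u :: "nat \<Rightarrow> 'n set \<Rightarrow> complex \<Rightarrow> real"
  assumes x: "x \<in> circular_set D - real_axis"
    and u: "\<And>A j z. z \<in> D \<Longrightarrow> Im z \<noteq> 0 \<Longrightarrow> has_dir_deriv (u j A) (ub j A z) \<i> z"
      "\<And>A j z. z \<in> D \<Longrightarrow> Im z \<noteq> 0 \<Longrightarrow> has_dir_deriv (u j A) (ua j A z) 1 z"
    and sum: "\<And>A z. z \<in> D \<Longrightarrow> Im z \<noteq> 0 \<Longrightarrow> weighted_sum n (\<lambda>j. u j A) z = sph (stem_comp F A) k z"
    and g: "\<And>j z. z \<in> D \<Longrightarrow> Im z \<noteq> 0 \<Longrightarrow> g j z = (\<chi> A. u j A z)"
  shows "(\<Sum>j=1..n. acoeff n j *\<^sub>R slice_deriv (stem_of (\<lambda>z. Im z powi (int j - 2 * int n) *\<^sub>R g j z)) x)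
    = slice_tower F k x"
proof -
  define z where "z = slice_coord x"
  have z: "z \<in> D" "Im z = norm (snd x)" "Im z \<noteq> 0"
    using x circular_set_iff[OF D(2), of x] by (auto simp: z_def Im_slice_coord real_axis_def vec_eq_iff)
  have gd: "has_dir_deriv (g j) (\<chi> A. ub j A z) \<i> z" "has_dir_deriv (g j) (\<chi> A. ua j A z) 1 z" for j
  proof -
    have S: "z \<in> D \<inter> {z. Im z \<noteq> 0}" using z by simp
    show "has_dir_deriv (g j) (\<chi> A. ub j A z) \<i> z"
      by (rule has_dir_deriv_cong[OF has_dir_deriv_vec[OF u(1)[OF z(1,3)]] open_off_real S]) (simp add: g)
    show "has_dir_deriv (g j) (\<chi> A. ua j A z) 1 z"
      by (rule has_dir_deriv_cong[OF has_dir_deriv_vec[OF u(2)[OF z(1,3)]] open_off_real S]) (simp add: g)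
  qed
  have "(\<Sum>j=1..n. acoeff n j *\<^sub>R slice_deriv (stem_of (\<lambda>z. Im z powi (int j - 2 * int n) *\<^sub>R g j z)) x)
    = (1 / 2) *\<^sub>R (slice_sph F 1 k z - para (0, sgn (snd x)) \<odot> (norm (snd x) *\<^sub>R slice_sph F 0 (Suc k) z))"
  \<comment> \<open>The weighted sum is \<open>slice_sph F 0 k\<close>, whose derivatives in
    \<alpha> and \<beta> are the two ingredients of \<open>slice_tower\<close>.\<close>
  proof (rule sum_slice_deriv_stem_of[where x = x and p = "slice_sph F 0 k", folded z_def,
        OF has_dir_deriv_scaleR[OF has_dir_deriv_Im_powi(2) gd(2)]
        has_dir_deriv_scaleR[OF has_dir_deriv_Im_powi(1) gd(1)] open_off_real])
    show "slice_sph F 0 k w = (\<Sum>j=1..n. acoeff n j *\<^sub>R (Im w powi (int j - 2 * int n) *\<^sub>R g j w))"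
      if "w \<in> D \<inter> {z. Im z \<noteq> 0}" for w
      using that sum[of w] by (simp add: g slice_sph_def weighted_sum_def vec_eq_iff mult.assoc)
    show "has_dir_deriv (slice_sph F 0 k) (norm (snd x) *\<^sub>R slice_sph F 0 (Suc k) z) \<i> z"
      "has_dir_deriv (slice_sph F 0 k) (slice_sph F 1 k z) 1 z"
      using has_dir_deriv_slice_sph[OF z(1), of 0 k] z(2) by simp_all
  qed (use z in auto)
  then show ?thesis
    by (simp add: slice_tower_def z_def cl_mult.scaleR_right flip: para_sgn cl_mult.scaleR_left)
qed

lemma slice_tower_spherical_deriv:
  assumes x: "x \<in> circular_set D - real_axis" and "k \<ge> 1"
  shows "(\<Sum>j=1..k. acoeff k j *\<^sub>R slice_deriv (stem_of
      (\<lambda>z. Im z powi (int j - 2 * int k) *\<^sub>R (d_beta ^^ j) (spherical_deriv F) z)) x) = slice_tower F k x"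
proof (rule slice_tower_eq_sum[OF x])
  show "has_dir_deriv (deriv_sph (stem_comp F A) j) (deriv_sph (stem_comp F A) (Suc j) z) \<i> z"
    "has_dir_deriv (deriv_sph (stem_comp F A) j) (deriv_sph (deriv (stem_comp F A)) j z) 1 z"
    if "z \<in> D" "Im z \<noteq> 0" for A j z
    using that D holomorphic_comp[of 0] by (auto intro!: has_dir_deriv_deriv_sph simp del: deriv_sph.simps)
  show "weighted_sum k (\<lambda>j. deriv_sph (stem_comp F A) j) z = sph (stem_comp F A) k z"
    if "z \<in> D" "Im z \<noteq> 0" for A z
    using weighted_sum_deriv_sph[OF intrinsic_comp[of 0 A] D(1) that \<open>k \<ge> 1\<close>] by simp
qed (simp add: d_beta_iterate_spherical_deriv)

lemma slice_tower_stem: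
  assumes x: "x \<in> circular_set D - real_axis"
  shows "(\<Sum>j=1..k + 1. acoeff (k + 1) j *\<^sub>R slice_deriv (stem_of
      (\<lambda>z. Im z powi (int j - 2 * int (k + 1)) *\<^sub>R (d_beta ^^ (j - 1)) (\<lambda>w. snd (F w)) z)) x) = slice_tower F k x"
proof (rule slice_tower_eq_sum[OF x])
  \<comment> \<open>The index is \<open>Suc (j - 1)\<close> rather than \<open>j\<close> because the
    hypotheses on \<open>u\<close> include j = 0, where \<open>j - 1\<close> truncates to 0.\<close>
  show "has_dir_deriv (deriv_Im (stem_comp F A) (j - 1)) (deriv_Im (stem_comp F A) (Suc (j - 1)) z) \<i> z"
    "has_dir_deriv (deriv_Im (stem_comp F A) (j - 1)) (deriv_Im (deriv (stem_comp F A)) (j - 1) z) 1 z"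
    if "z \<in> D" "Im z \<noteq> 0" for A j z
    using that D holomorphic_comp[of 0] by (auto intro!: has_dir_deriv_deriv_Im)
qed (simp_all add: d_beta_iterate_snd sph_def)

end

theorem theorem3p5:
  fixes m :: nat
    and D :: "complex set"
    and F :: "'n::{finite,linorder} stem"
    and f :: "'n paravec \<Rightarrow> 'n clifford"
  assumes "CARD('n) = m" and "odd m"
    and "open D" and "symmetric_set D"
    and "slice_regular D F f"
  shows "(\<forall>k\<ge>1. \<forall>x\<in>circular_set D - real_axis.
            (laplacian ^^ (k + 1)) f x =
              (- 2 * (\<Prod>i=0..k. real m - real (2 * i + 1))) *\<^sub>R
              (\<Sum>j=1..k. acoeff k j *\<^sub>R
                 slice_deriv (stem_of (\<lambda>z. Im z powi (int j - 2 * int k) *\<^sub>R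
                   (d_beta ^^ j) (spherical_deriv F) z)) x) \<and>
            (laplacian ^^ (k + 1)) f x =
              (- 2 * (\<Prod>i=0..k. real m - real (2 * i + 1))) *\<^sub>R
              (\<Sum>j=1..k+1. acoeff (k + 1) j *\<^sub>R
                 slice_deriv (stem_of (\<lambda>z. Im z powi (int j - 2 * int k - 2) *\<^sub>R
                   (d_beta ^^ (j - 1)) (\<lambda>w. snd (F w)) z)) x)) \<and>
         (\<forall>x\<in>circular_set D. (laplacian ^^ ((m + 1) div 2)) f x = 0)"
proof (intro conjI allI impI ballI)
  note hyp = assms(3-5)
  fix k :: nat and x :: "'n paravec"
  assume "k \<ge> 1" and x: "x \<in> circular_set D - real_axis"
  then have L: "(laplacian ^^ (k + 1)) f x =
      (- 2 * (\<Prod>i=0..k. real m - real (2 * i + 1))) *\<^sub>R slice_tower F k x"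
    using iterated_laplacian[OF hyp, of x k] assms(1) by simp
  show "(laplacian ^^ (k + 1)) f x =
      (- 2 * (\<Prod>i=0..k. real m - real (2 * i + 1))) *\<^sub>R
      (\<Sum>j=1..k. acoeff k j *\<^sub>R
         slice_deriv (stem_of (\<lambda>z. Im z powi (int j - 2 * int k) *\<^sub>R
           (d_beta ^^ j) (spherical_deriv F) z)) x)"
    unfolding L slice_tower_spherical_deriv[OF hyp x \<open>k \<ge> 1\<close>] ..
  have e: "int j - 2 * int k - 2 = int j - 2 * int (k + 1)" for j by simp
  show "(laplacian ^^ (k + 1)) f x =
      (- 2 * (\<Prod>i=0..k. real m - real (2 * i + 1))) *\<^sub>R
      (\<Sum>j=1..k+1. acoeff (k + 1) j *\<^sub>R
         slice_deriv (stem_of (\<lambda>z. Im z powi (int j - 2 * int k - 2) *\<^sub>R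
           (d_beta ^^ (j - 1)) (\<lambda>w. snd (F w)) z)) x)"
    unfolding L e slice_tower_stem[OF hyp x] ..
next
  fix x :: "'n paravec" assume x: "x \<in> circular_set D"
  \<comment> \<open>The factor with i = k is m - (2k + 1) = 0, and (m + 1) div 2 = k + 1. Since
    \<open>iterated_laplacian\<close> holds on all of \<open>circular_set D\<close>, real points are
    covered.\<close>
  obtain k where k: "m = 2 * k + 1" using \<open>odd m\<close> by (rule oddE)
  then have "(\<Prod>i=0..k. real m - real (2 * i + 1)) = 0" by (intro prod_zero) auto
  then show "(laplacian ^^ ((m + 1) div 2)) f x = 0"
    using iterated_laplacian[OF assms(3-5) x, of k] assms(1) by (simp add: k)
qed

end
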